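(* Let $r\in\mathbb{Z}_+$, let $M$ be a module over the Lie algebra $\mathfrak{a}_r$, and let $\alpha\in\mathbb{C}$. Then the actions $$d_m (v\otimes t^n)=\Big(\Big(\alpha+n+\sum_{i=0}^r\frac{m^{i+1}}{(i+1)!}\bar d_i\Big)v\Big)\otimes t^{n+m},\qquad c(v\otimes t^n)=0\qquad (m,n\in\mathbb{Z},\ v\in M)$$ make the vector space $\mathcal{N}(M,\alpha)=M\otimes\mathbb{C}[t,t^{-1}]$ into a module over the Virasoro algebra $\mathfrak{V}$.
   Context: $\mathbb{Z}_+$ is the set of nonnegative integers. The Virasoro algebra $\mathfrak{V}$ is the complex Lie algebra with basis $\{c,d_i: i\in\mathbb{Z}\}$ and bracket $[d_i,d_j]=(j-i)d_{i+j}+\delta_{i,-j}\frac{i^3-i}{12}c$, $[d_i,c]=0$ for $i,j\in\mathbb{Z}$. Let $\mathfrak{V}_+$ be the Lie subalgebra of $\mathfrak{V}$ spanned by all $d_i$ with $i\geq 0$. For $r\in\mathbb{Z}_+$ let $\mathfrak{V}_+^{(r)}$ be the Lie subalgebra generated by all $d_i$ with $i>r$ (it is an ideal of $\mathfrak{V}_+$), let $\mathfrak{a}_r=\mathfrak{V}_+/\mathfrak{V}_+^{(r)}$, and let $\bar d_i$ be the image of $d_i$ in $\mathfrak{a}_r$. *)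

theory Defs
  imports "HOL-Algebra.Algebra" "HOL-Algebra.Algebraic_Closure_Type" "HOL-Library.Poly_Mapping"
begin

section \<open>Lie algebras and their modules\<close>

text \<open>A Lie algebra over a field \<open>K\<close> is a \<open>K\<close>-module record whose field \<^const>\<open>monoid.mult\<close> is the
  Lie bracket. The field \<^const>\<open>one\<close> is present in every module record and has no meaning here.\<close>

locale lie_algebra = field K + module K L for K (structure) and L (structure) +
  assumes bracket_closed:
      "x \<in> carrier L \<Longrightarrow> y \<in> carrier L \<Longrightarrow> x \<otimes>\<^bsub>L\<^esub> y \<in> carrier L"
    and bracket_add_left:
      "x \<in> carrier L \<Longrightarrow> y \<in> carrier L \<Longrightarrow> z \<in> carrier L \<Longrightarrow>
        (x \<oplus>\<^bsub>L\<^esub> y) \<otimes>\<^bsub>L\<^esub> z = (x \<otimes>\<^bsub>L\<^esub> z) \<oplus>\<^bsub>L\<^esub> (y \<otimes>\<^bsub>L\<^esub> z)"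
    and bracket_add_right:
      "x \<in> carrier L \<Longrightarrow> y \<in> carrier L \<Longrightarrow> z \<in> carrier L \<Longrightarrow>
        x \<otimes>\<^bsub>L\<^esub> (y \<oplus>\<^bsub>L\<^esub> z) = (x \<otimes>\<^bsub>L\<^esub> y) \<oplus>\<^bsub>L\<^esub> (x \<otimes>\<^bsub>L\<^esub> z)"
    and bracket_smult_left:
      "a \<in> carrier K \<Longrightarrow> x \<in> carrier L \<Longrightarrow> y \<in> carrier L \<Longrightarrow>
        (a \<odot>\<^bsub>L\<^esub> x) \<otimes>\<^bsub>L\<^esub> y = a \<odot>\<^bsub>L\<^esub> (x \<otimes>\<^bsub>L\<^esub> y)"
    and bracket_smult_right:
      "a \<in> carrier K \<Longrightarrow> x \<in> carrier L \<Longrightarrow> y \<in> carrier L \<Longrightarrow>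
        x \<otimes>\<^bsub>L\<^esub> (a \<odot>\<^bsub>L\<^esub> y) = a \<odot>\<^bsub>L\<^esub> (x \<otimes>\<^bsub>L\<^esub> y)"
    and bracket_self: "x \<in> carrier L \<Longrightarrow> x \<otimes>\<^bsub>L\<^esub> x = \<zero>\<^bsub>L\<^esub>"
    and jacobi:
      "x \<in> carrier L \<Longrightarrow> y \<in> carrier L \<Longrightarrow> z \<in> carrier L \<Longrightarrow>
        x \<otimes>\<^bsub>L\<^esub> (y \<otimes>\<^bsub>L\<^esub> z) \<oplus>\<^bsub>L\<^esub> y \<otimes>\<^bsub>L\<^esub> (z \<otimes>\<^bsub>L\<^esub> x) \<oplus>\<^bsub>L\<^esub> z \<otimes>\<^bsub>L\<^esub> (x \<otimes>\<^bsub>L\<^esub> y) = \<zero>\<^bsub>L\<^esub>"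

locale lie_module = lie_algebra K L + M: module K M
  for K :: "('a, 'k) ring_scheme" (structure) and L :: "('a, 'b, 'l) module_scheme" (structure)
    and M :: "('a, 'c, 'm) module_scheme" (structure) +
  fixes act :: "'b \<Rightarrow> 'c \<Rightarrow> 'c"
  assumes act_closed: "x \<in> carrier L \<Longrightarrow> v \<in> carrier M \<Longrightarrow> act x v \<in> carrier M"
    and act_add_left:
      "x \<in> carrier L \<Longrightarrow> y \<in> carrier L \<Longrightarrow> v \<in> carrier M \<Longrightarrow>
        act (x \<oplus>\<^bsub>L\<^esub> y) v = act x v \<oplus>\<^bsub>M\<^esub> act y v"
    and act_add_right:
      "x \<in> carrier L \<Longrightarrow> v \<in> carrier M \<Longrightarrow> w \<in> carrier M \<Longrightarrow>
        act x (v \<oplus>\<^bsub>M\<^esub> w) = act x v \<oplus>\<^bsub>M\<^esub> act x w"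
    and act_smult_left:
      "a \<in> carrier K \<Longrightarrow> x \<in> carrier L \<Longrightarrow> v \<in> carrier M \<Longrightarrow>
        act (a \<odot>\<^bsub>L\<^esub> x) v = a \<odot>\<^bsub>M\<^esub> act x v"
    and act_smult_right:
      "a \<in> carrier K \<Longrightarrow> x \<in> carrier L \<Longrightarrow> v \<in> carrier M \<Longrightarrow>
        act x (a \<odot>\<^bsub>M\<^esub> v) = a \<odot>\<^bsub>M\<^esub> act x v"
    and act_bracket:
      "x \<in> carrier L \<Longrightarrow> y \<in> carrier L \<Longrightarrow> v \<in> carrier M \<Longrightarrow>
        act (x \<otimes>\<^bsub>L\<^esub> y) v = act x (act y v) \<ominus>\<^bsub>M\<^esub> act y (act x v)"

locale lie_subalgebra = submodule H K L for H and K (structure) and L (structure) +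
  assumes bracket_closed: "x \<in> H \<Longrightarrow> y \<in> H \<Longrightarrow> x \<otimes>\<^bsub>L\<^esub> y \<in> H"

definition module_span ::
    "('a, 'c) ring_scheme \<Rightarrow> ('a, 'b, 'd) module_scheme \<Rightarrow> 'b set \<Rightarrow> 'b set"
  where "module_span K M S = (\<lambda>H. submodule H K M) hull S"

definition lie_generated ::
    "('a, 'c) ring_scheme \<Rightarrow> ('a, 'b, 'd) module_scheme \<Rightarrow> 'b set \<Rightarrow> 'b set"
  where "lie_generated K L S = (\<lambda>H. lie_subalgebra H K L) hull S"

text \<open>The quotient of a module by a submodule. Its underlying ring record is the library's
  quotient, so that for an ideal of a Lie algebra \<^const>\<open>monoid.mult\<close> is the induced bracket on cosets.\<close>

definition quotient_module ::
    "('a, 'b, 'd) module_scheme \<Rightarrow> 'b set \<Rightarrow> ('a, 'b set) module"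
  where "quotient_module M H =
    \<lparr>carrier = carrier (M Quot H), monoid.mult = monoid.mult (M Quot H), one = one (M Quot H),
     ring.zero = ring.zero (M Quot H), add = add (M Quot H),
     module.smult = (\<lambda>a A. \<Union>x\<in>A. H +>\<^bsub>M\<^esub> (a \<odot>\<^bsub>M\<^esub> x))\<rparr>"


section \<open>Complex vector spaces and tensor products\<close>

abbreviation complex_field :: "complex ring"
  where "complex_field \<equiv> ring_of_type_algebra"

abbreviation scale :: "complex \<Rightarrow> ('a \<Rightarrow>\<^sub>0 complex) \<Rightarrow> ('a \<Rightarrow>\<^sub>0 complex)"
  where "scale a \<equiv> Poly_Mapping.map ((*) a)"

text \<open>The complex vector space with basis \<open>S\<close>, as finitely supported functions. The fields \<^const>\<open>monoid.mult\<close> and \<^const>\<open>one\<close> play no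
  role until they are updated.\<close>

definition free_space :: "'a set \<Rightarrow> (complex, 'a \<Rightarrow>\<^sub>0 complex) module"
  where "free_space S =
    \<lparr>carrier = {f. Poly_Mapping.keys f \<subseteq> S}, monoid.mult = (\<lambda>_ _. 0), one = 0, ring.zero = 0, add = (+),
     module.smult = scale\<rparr>"

definition tensor_relations ::
    "(complex, 'a, 'c) module_scheme \<Rightarrow> (complex, 'b, 'd) module_scheme \<Rightarrow> ('a \<times> 'b \<Rightarrow>\<^sub>0 complex) set"
  where "tensor_relations V W =
    (let e = (\<lambda>v w. Poly_Mapping.single (v, w) 1) in
      {e (u \<oplus>\<^bsub>V\<^esub> v) w - e u w - e v w | u v w. u \<in> carrier V \<and> v \<in> carrier V \<and> w \<in> carrier W}
    \<union> {e v (w \<oplus>\<^bsub>W\<^esub> z) - e v w - e v z | v w z. v \<in> carrier V \<and> w \<in> carrier W \<and> z \<in> carrier W}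
    \<union> {e (a \<odot>\<^bsub>V\<^esub> v) w - scale a (e v w) | a v w. v \<in> carrier V \<and> w \<in> carrier W}
    \<union> {e v (a \<odot>\<^bsub>W\<^esub> w) - scale a (e v w) | a v w. v \<in> carrier V \<and> w \<in> carrier W})"

definition tensor_kernel ::
    "(complex, 'a, 'c) module_scheme \<Rightarrow> (complex, 'b, 'd) module_scheme \<Rightarrow> ('a \<times> 'b \<Rightarrow>\<^sub>0 complex) set"
  where "tensor_kernel V W =
    module_span complex_field (free_space (carrier V \<times> carrier W)) (tensor_relations V W)"

definition tensor_space ::
    "(complex, 'a, 'c) module_scheme \<Rightarrow> (complex, 'b, 'd) module_scheme \<Rightarrow>
      (complex, ('a \<times> 'b \<Rightarrow>\<^sub>0 complex) set) module"
  where "tensor_space V W =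
    quotient_module (free_space (carrier V \<times> carrier W)) (tensor_kernel V W)"

definition pure_tensor ::
    "(complex, 'a, 'c) module_scheme \<Rightarrow> (complex, 'b, 'd) module_scheme \<Rightarrow> 'a \<Rightarrow> 'b \<Rightarrow>
      ('a \<times> 'b \<Rightarrow>\<^sub>0 complex) set"
  where "pure_tensor V W v w =
    tensor_kernel V W +>\<^bsub>free_space (carrier V \<times> carrier W)\<^esub> Poly_Mapping.single (v, w) 1"

text \<open>Multiplication in \<^typ>\<open>int \<Rightarrow>\<^sub>0 complex\<close> is convolution, which makes it the algebra of Laurent
  polynomials.\<close>

definition laurent :: "(complex, int \<Rightarrow>\<^sub>0 complex) module"
  where "laurent = free_space UNIV \<lparr>monoid.mult := (*), one := 1\<rparr>"

definition t_power :: "int \<Rightarrow> (int \<Rightarrow>\<^sub>0 complex)"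
  where "t_power n = Poly_Mapping.single n 1"


section \<open>The Virasoro algebra\<close>

datatype virasoro_basis = Central | Gen int

definition vir_c :: "virasoro_basis \<Rightarrow>\<^sub>0 complex"
  where "vir_c = Poly_Mapping.single Central 1"

definition vir_d :: "int \<Rightarrow> (virasoro_basis \<Rightarrow>\<^sub>0 complex)"
  where "vir_d i = Poly_Mapping.single (Gen i) 1"

fun basis_bracket :: "virasoro_basis \<Rightarrow> virasoro_basis \<Rightarrow> (virasoro_basis \<Rightarrow>\<^sub>0 complex)"
  where
    "basis_bracket (Gen i) (Gen j) =
      scale (of_int (j - i)) (vir_d (i + j)) +
      (if i = - j then scale ((of_int i ^ 3 - of_int i) / 12) vir_c else 0)"
  | "basis_bracket Central _ = 0"
  | "basis_bracket _ Central = 0"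

definition vir_bracket ::
    "(virasoro_basis \<Rightarrow>\<^sub>0 complex) \<Rightarrow> (virasoro_basis \<Rightarrow>\<^sub>0 complex) \<Rightarrow> (virasoro_basis \<Rightarrow>\<^sub>0 complex)"
  where "vir_bracket x y =
    (\<Sum>g\<in>Poly_Mapping.keys x. \<Sum>h\<in>Poly_Mapping.keys y.
      scale (Poly_Mapping.lookup x g * Poly_Mapping.lookup y h) (basis_bracket g h))"

definition virasoro :: "(complex, virasoro_basis \<Rightarrow>\<^sub>0 complex) module"
  where "virasoro = free_space UNIV \<lparr>monoid.mult := vir_bracket\<rparr>"

definition virasoro_plus :: "(complex, virasoro_basis \<Rightarrow>\<^sub>0 complex) module"
  where "virasoro_plus =
    virasoro \<lparr>carrier := module_span complex_field virasoro {vir_d i | i. i \<ge> 0}\<rparr>"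

definition virasoro_ideal :: "nat \<Rightarrow> (virasoro_basis \<Rightarrow>\<^sub>0 complex) set"
  where "virasoro_ideal r = lie_generated complex_field virasoro {vir_d i | i. i > int r}"

definition a_algebra :: "nat \<Rightarrow> (complex, (virasoro_basis \<Rightarrow>\<^sub>0 complex) set) module"
  where "a_algebra r = quotient_module virasoro_plus (virasoro_ideal r)"

definition d_bar :: "nat \<Rightarrow> int \<Rightarrow> (virasoro_basis \<Rightarrow>\<^sub>0 complex) set"
  where "d_bar r i = virasoro_ideal r +>\<^bsub>virasoro_plus\<^esub> vir_d i"

end

theory Submission
  imports Defs
begin

text \<open>Write \<open>D(m) = \<Sum>\<^sub>i m\<^sup>i\<^sup>+\<^sup>1/(i+1)! d\<^sub>i\<close>, the sum over \<open>0 \<le> i \<le> r\<close>. The operators of the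
statement are \<open>d\<^sub>m (v \<otimes> t\<^sup>n) = (\<alpha> + n + D(m)) v \<otimes> t\<^sup>n\<^sup>+\<^sup>m\<close>, and comparing \<open>d\<^sub>m d\<^sub>n - d\<^sub>n d\<^sub>m\<close> with
\<open>(n - m) d\<^sub>m\<^sub>+\<^sub>n\<close> on \<open>v \<otimes> t\<^sup>k\<close> reduces the module axiom to the single relation
\<open>[D(m), D(n)] + n D(n) = (n - m) D(m + n) + m D(m)\<close> in the quotient algebra. The coefficient of
\<open>d\<^sub>s\<close> in the bracket is \<open>\<Sum> m\<^sup>a n\<^sup>b (b - a)/(a! b!)\<close> over \<open>a + b = s + 2\<close> with \<open>a, b \<ge> 1\<close>. Over all
\<open>a, b \<ge> 0\<close> the binomial theorem gives \<open>(n - m) (m + n)\<^sup>s\<^sup>+\<^sup>1/(s + 1)!\<close>, and the two omitted boundary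
terms are the corrections \<open>n D(n)\<close> and \<open>m D(m)\<close>. All \<open>d\<^sub>s\<close> with \<open>s > r\<close> vanish in the quotient,
so only \<open>s \<le> r\<close> matters. This is \<open>bracket_coefficient\<close> and \<open>generating_vector_bracket\<close>. The
operators \<open>d\<^sub>m\<close> thus satisfy the Virasoro relations without the central term, which is why the
central element acts by zero.

Apart from \<open>M\<close>, every space involved is a space of finitely supported functions or a quotient of one by a subspace,
so the linear algebra happens on representatives. The operators are written down on the
free space over \<open>M \<times> \<complex>[t,t\<inverse>]\<close>, extending linearly in the Laurent polynomial as well; they
preserve the span of the tensor relations (\<open>lifted_action_kernel\<close>) and therefore descend.
Modulo that span the free space is spanned by the \<open>(v, t\<^sup>n)\<close> (\<open>free_space_spanned\<close>). This
settles both halves of the claim: the bracket axiom has to be checked on generators only, and a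
module structure is determined by its values there.\<close>

section \<open>Linear algebra of finitely supported functions\<close>

lemma lookup_scale [simp]: "Poly_Mapping.lookup (scale a f) k = a * Poly_Mapping.lookup f k"
  by (auto simp: Poly_Mapping.map.rep_eq when_def)

interpretation finsupp: vector_space scale
  by unfold_locales (auto intro!: poly_mapping_eqI simp: lookup_add algebra_simps)

text \<open>All bilinear operations below (the bracket, the action on representatives) are iterated linear
  extensions of functions on basis elements.\<close>

definition linear_extension :: "('a \<Rightarrow> ('b \<Rightarrow>\<^sub>0 complex)) \<Rightarrow> ('a \<Rightarrow>\<^sub>0 complex) \<Rightarrow> ('b \<Rightarrow>\<^sub>0 complex)"
  where "linear_extension b f =
    (\<Sum>k\<in>Poly_Mapping.keys f. scale (Poly_Mapping.lookup f k) (b k))"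

lemma linear_extension_superset:
  assumes "finite A" "Poly_Mapping.keys f \<subseteq> A"
  shows "linear_extension b f = (\<Sum>k\<in>A. scale (Poly_Mapping.lookup f k) (b k))"
  unfolding linear_extension_def using assms
  by (intro sum.mono_neutral_left) (auto simp: in_keys_iff)

lemma linear_extension_add:
  "linear_extension b (f + g) = linear_extension b f + linear_extension b g"
proof -
  let ?A = "Poly_Mapping.keys f \<union> Poly_Mapping.keys g"
  have "linear_extension b h = (\<Sum>k\<in>?A. scale (Poly_Mapping.lookup h k) (b k))"
    if "h \<in> {f, g, f + g}" for h
    using that Poly_Mapping.keys_add[of f g] by (intro linear_extension_superset) auto
  then show ?thesis
    by (simp add: lookup_add finsupp.scale_left_distrib sum.distrib)
qed

lemma keys_scale: "Poly_Mapping.keys (scale a f) \<subseteq> Poly_Mapping.keys f"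
  by (auto simp: in_keys_iff)

lemma linear_extension_scale:
  "linear_extension b (scale a f) = scale a (linear_extension b f)"
  using linear_extension_superset[OF finite_keys keys_scale, of b a f]
  by (simp add: linear_extension_def finsupp.scale_sum_right)

lemma linear_linear_extension: "Vector_Spaces.linear scale scale (linear_extension b)"
  by unfold_locales (simp_all add: linear_extension_add linear_extension_scale)

lemma linear_extension_zero [simp]: "linear_extension b 0 = 0"
  by (simp add: linear_extension_def)

lemma linear_extension_single [simp]: "linear_extension b (Poly_Mapping.single k a) = scale a (b k)"
  by (simp add: linear_extension_def)

lemma linear_extension_diff:
  "linear_extension b (f - g) = linear_extension b f - linear_extension b g"
  by (metis add_diff_cancel diff_add_cancel linear_extension_add)

lemma linear_extension_fun_add:
  "linear_extension (\<lambda>k. b k + b' k) f = linear_extension b f + linear_extension b' f"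
  by (simp add: linear_extension_def finsupp.scale_right_distrib sum.distrib)

lemma linear_extension_fun_scale:
  "linear_extension (\<lambda>k. scale a (b k)) f = scale a (linear_extension b f)"
  by (simp add: linear_extension_def finsupp.scale_sum_right mult.commute)

lemma linear_extension_fun_diff:
  "linear_extension (\<lambda>k. b k - b' k) f = linear_extension b f - linear_extension b' f"
  by (simp add: linear_extension_def finsupp.scale_right_diff_distrib sum_subtractf)

lemma linear_extension_fun_zero [simp]: "linear_extension (\<lambda>k. 0) f = 0"
  by (simp add: linear_extension_def)

lemma linear_extension_mem:
  assumes "finsupp.subspace H" "\<And>k. k \<in> Poly_Mapping.keys f \<Longrightarrow> b k \<in> H"
  shows "linear_extension b f \<in> H"
  unfolding linear_extension_def
  using assms by (auto intro: finsupp.subspace_sum finsupp.subspace_scale)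

lemma linear_extension_basis: "linear_extension (\<lambda>k. Poly_Mapping.single k 1) f = f"
proof (rule poly_mapping_eqI)
  fix k
  have "Poly_Mapping.lookup (linear_extension (\<lambda>k. Poly_Mapping.single k 1) f) k =
      (\<Sum>j\<in>Poly_Mapping.keys f. Poly_Mapping.lookup f j when j = k)"
    by (auto simp: linear_extension_def lookup_sum lookup_single when_def intro!: sum.cong)
  then show "Poly_Mapping.lookup (linear_extension (\<lambda>k. Poly_Mapping.single k 1) f) k =
      Poly_Mapping.lookup f k"
    by (simp add: when_def sum.delta in_keys_iff)
qed

lemma subspace_mem_of_basis:
  assumes "finsupp.subspace H" "\<And>k. k \<in> Poly_Mapping.keys f \<Longrightarrow> Poly_Mapping.single k 1 \<in> H"
  shows "f \<in> H"
  using linear_extension_mem[OF assms(1), of f "\<lambda>k. Poly_Mapping.single k 1"] assms(2)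
  by (simp add: linear_extension_basis)

text \<open>The form in which identities are reduced to basis elements: with \<open>H = {0}\<close> this gives
  the vanishing of a linear map, with a larger \<open>H\<close> its vanishing modulo \<open>H\<close>.\<close>

lemma linear_mem_of_basis:
  assumes "Vector_Spaces.linear scale scale T" "finsupp.subspace H"
    and "\<And>k. k \<in> Poly_Mapping.keys f \<Longrightarrow> T (Poly_Mapping.single k 1) \<in> H"
  shows "T f \<in> H"
proof -
  interpret T: Vector_Spaces.linear scale scale T by fact
  have "f \<in> {f. T f \<in> H}"
    by (rule subspace_mem_of_basis[OF T.subspace_linear_preimage[OF assms(2)]])
      (simp add: assms(3))
  then show ?thesis by simp
qed

lemma subspace_supported: "finsupp.subspace {f. Poly_Mapping.keys f \<subseteq> S}"
proof (rule finsupp.subspaceI)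
  show "f + g \<in> {f. Poly_Mapping.keys f \<subseteq> S}"
    if "f \<in> {f. Poly_Mapping.keys f \<subseteq> S}" "g \<in> {f. Poly_Mapping.keys f \<subseteq> S}" for f g
    using that Poly_Mapping.keys_add[of f g] by blast
  show "scale a f \<in> {f. Poly_Mapping.keys f \<subseteq> S}"
    if "f \<in> {f. Poly_Mapping.keys f \<subseteq> S}" for a f
    using that keys_scale[of a f] by blast
qed simp

lemma span_singles: "finsupp.span {Poly_Mapping.single k 1 | k. k \<in> S} = {f. Poly_Mapping.keys f \<subseteq> S}"
proof (rule finsupp.span_unique)
  show "{Poly_Mapping.single k (1::complex) | k. k \<in> S} \<subseteq> {f. Poly_Mapping.keys f \<subseteq> S}"
    by auto
  show "{f. Poly_Mapping.keys f \<subseteq> S} \<subseteq> H"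
    if H: "{Poly_Mapping.single k 1 | k. k \<in> S} \<subseteq> H" "finsupp.subspace H" for H
  proof
    fix f :: "'a \<Rightarrow>\<^sub>0 complex" assume f: "f \<in> {f. Poly_Mapping.keys f \<subseteq> S}"
    show "f \<in> H"
      by (rule subspace_mem_of_basis[OF H(2)]) (use H(1) f in blast)
  qed
qed (rule subspace_supported)

section \<open>Quotients of spaces of finitely supported functions\<close>

lemma complex_field_simps [simp]:
  "carrier complex_field = UNIV" "x \<oplus>\<^bsub>complex_field\<^esub> y = x + y" "x \<otimes>\<^bsub>complex_field\<^esub> y = x * y"
  "\<zero>\<^bsub>complex_field\<^esub> = 0" "\<one>\<^bsub>complex_field\<^esub> = 1"
  by (simp_all add: ring_of_type_algebra_def)

lemma field_complex_field: "field complex_field"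
  by (rule field_from_type_algebra)

lemma cring_complex_field: "cring complex_field"
  by (rule cring_from_type_algebra)

text \<open>Module records whose additive structure is that of the underlying type. The multiplication is left
  open, because the same vector space occurs with different brackets.\<close>

locale finsupp_module =
  fixes M :: "(complex, 'a \<Rightarrow>\<^sub>0 complex) module"
  assumes add_eq [simp]: "add M = (+)"
    and zero_eq [simp]: "\<zero>\<^bsub>M\<^esub> = 0"
    and smult_eq [simp]: "module.smult M = scale"
    and subspace_carrier: "finsupp.subspace (carrier M)"
begin

lemma is_module: "module complex_field M"
proof (rule moduleI)
  show "abelian_group M"
  proof (rule abelian_groupI)
    fix x assume "x \<in> carrier M"
    then show "\<exists>y\<in>carrier M. y \<oplus>\<^bsub>M\<^esub> x = \<zero>\<^bsub>M\<^esub>"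
      using finsupp.subspace_neg[OF subspace_carrier] by (intro bexI[of _ "- x"]) auto
  qed (use subspace_carrier in \<open>auto simp: finsupp.subspace_def algebra_simps\<close>)
qed (use subspace_carrier in \<open>auto simp: cring_complex_field finsupp.subspace_def
      finsupp.scale_left_distrib finsupp.scale_right_distrib\<close>)

sublocale M: Module.module complex_field M
  by (rule is_module)

lemma neg_eq: "x \<in> carrier M \<Longrightarrow> \<ominus>\<^bsub>M\<^esub> x = - x"
  using M.minus_equality[of "- x" x] finsupp.subspace_neg[OF subspace_carrier] by auto

lemma submodule_iff: "submodule H complex_field M \<longleftrightarrow> H \<subseteq> carrier M \<and> finsupp.subspace H"
proof
  assume H: "submodule H complex_field M"
  then obtain x where "x \<in> H"
    using M.submoduleE(2) by blast
  then have "scale 0 x \<in> H"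
    using M.submoduleE(4)[OF H, of 0 x] by simp
  then have "0 \<in> H"
    by simp
  then show "H \<subseteq> carrier M \<and> finsupp.subspace H"
    using M.submoduleE(1,4,5)[OF H] by (auto simp: finsupp.subspace_def)
next
  assume H: "H \<subseteq> carrier M \<and> finsupp.subspace H"
  then show "submodule H complex_field M"
    using finsupp.subspace_neg[of H]
    by (intro M.submoduleI) (auto simp: finsupp.subspace_def subset_iff neg_eq)
qed

lemma module_span_eq:
  assumes "S \<subseteq> carrier M"
  shows "module_span complex_field M S = finsupp.span S"
  unfolding module_span_def
proof (rule hull_unique)
  show "S \<subseteq> finsupp.span S"
    by (rule finsupp.span_superset)
  show "submodule (finsupp.span S) complex_field M"
    using assms finsupp.span_minimal subspace_carrier by (simp add: submodule_iff)
  show "finsupp.span S \<subseteq> H" if "S \<subseteq> H" "submodule H complex_field M" for H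
    using that by (intro finsupp.span_minimal) (auto simp: submodule_iff)
qed

end

locale finsupp_quotient = finsupp_module +
  fixes H
  assumes subspace_H: "finsupp.subspace H" and H_carrier: "H \<subseteq> carrier M"
begin

abbreviation coset where "coset x \<equiv> H +>\<^bsub>M\<^esub> x"

text \<open>Cosets are described by differences, so that equations between cosets become membership statements
  in the underlying type.\<close>

lemma coset_eq: "coset x = {y. y - x \<in> H}"
proof -
  have "coset x = (\<Union>h\<in>H. {h + x})"
    by (simp add: a_r_coset_def r_coset_def)
  also have "\<dots> = {y. y - x \<in> H}"
  proof (intro subset_antisym subsetI)
    fix y assume "y \<in> {y. y - x \<in> H}"
    then have "y - x \<in> H" "y = (y - x) + x"
      by auto
    then show "y \<in> (\<Union>h\<in>H. {h + x})"
      by blast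
  qed auto
  finally show ?thesis .
qed

lemma coset_eq_iff: "coset x = coset y \<longleftrightarrow> x - y \<in> H"
proof
  assume eq: "coset x = coset y"
  have "x \<in> coset x"
    using finsupp.subspace_0[OF subspace_H] by (simp add: coset_eq)
  then have "x \<in> coset y"
    by (simp only: eq)
  then show "x - y \<in> H"
    by (simp add: coset_eq)
next
  assume xy: "x - y \<in> H"
  have "z - x \<in> H \<longleftrightarrow> z - y \<in> H" for z
    using finsupp.subspace_add[OF subspace_H _ xy, of "z - x"]
      finsupp.subspace_diff[OF subspace_H _ xy, of "z - y"] by auto
  then show "coset x = coset y"
    by (simp add: coset_eq)
qed

lemma coset_of_mem: "x \<in> H \<Longrightarrow> coset x = H"
  using coset_eq_iff[of x 0] by (simp add: coset_eq)

lemma quotient_carrier: "carrier (quotient_module M H) = coset ` carrier M"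
  by (auto simp: quotient_module_def FactRing_def A_RCOSETS_def RCOSETS_def a_r_coset_def)

lemma quotient_zero: "\<zero>\<^bsub>quotient_module M H\<^esub> = coset 0"
  by (simp add: quotient_module_def FactRing_def coset_of_mem finsupp.subspace_0[OF subspace_H])

lemma quotient_add: "coset x \<oplus>\<^bsub>quotient_module M H\<^esub> coset y = coset (x + y)"
proof -
  have "coset x \<oplus>\<^bsub>quotient_module M H\<^esub> coset y = (\<Union>a\<in>coset x. \<Union>b\<in>coset y. {a + b})"
    by (simp add: quotient_module_def FactRing_def set_add_def set_mult_def)
  also have "\<dots> = coset (x + y)"
  proof (intro subset_antisym subsetI)
    fix z assume "z \<in> (\<Union>a\<in>coset x. \<Union>b\<in>coset y. {a + b})"
    then obtain a b where "z = a + b" "a - x \<in> H" "b - y \<in> H"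
      by (auto simp: coset_eq)
    then show "z \<in> coset (x + y)"
      using finsupp.subspace_add[OF subspace_H, of "a - x" "b - y"]
      by (simp add: coset_eq algebra_simps)
  next
    fix z assume "z \<in> coset (x + y)"
    then have "z - y \<in> coset x" "y \<in> coset y" "z = (z - y) + y"
      using finsupp.subspace_0[OF subspace_H] by (simp_all add: coset_eq algebra_simps)
    then show "z \<in> (\<Union>a\<in>coset x. \<Union>b\<in>coset y. {a + b})"
      by (intro UN_I[of "z - y"] UN_I[of y]) simp_all
  qed
  finally show ?thesis .
qed

lemma quotient_smult: "a \<odot>\<^bsub>quotient_module M H\<^esub> coset x = coset (scale a x)"
proof -
  have "coset (scale a y) = coset (scale a x)" if "y \<in> coset x" for y
    using that finsupp.subspace_scale[OF subspace_H, of "y - x" a]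
    by (simp add: coset_eq_iff coset_eq[of x] finsupp.scale_right_diff_distrib)
  moreover have "x \<in> coset x"
    using finsupp.subspace_0[OF subspace_H] by (simp add: coset_eq)
  ultimately have "(\<Union>y\<in>coset x. coset (scale a y)) = coset (scale a x)"
    by blast
  then show ?thesis
    by (simp add: quotient_module_def)
qed

text \<open>The premise is what an ideal supplies: the union over all representatives in the definition of the
  product of cosets then consists of one coset.\<close>

lemma quotient_mult:
  assumes "\<And>a b. a - x \<in> H \<Longrightarrow> b - y \<in> H \<Longrightarrow> (a \<otimes>\<^bsub>M\<^esub> b) - (x \<otimes>\<^bsub>M\<^esub> y) \<in> H"
  shows "coset x \<otimes>\<^bsub>quotient_module M H\<^esub> coset y = coset (x \<otimes>\<^bsub>M\<^esub> y)"
proof -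
  have "coset (a \<otimes>\<^bsub>M\<^esub> b) = coset (x \<otimes>\<^bsub>M\<^esub> y)" if "a \<in> coset x" "b \<in> coset y" for a b
    using assms that by (simp add: coset_eq_iff coset_eq[of x] coset_eq[of y])
  moreover have "x \<in> coset x" "y \<in> coset y"
    using finsupp.subspace_0[OF subspace_H] by (simp_all add: coset_eq)
  ultimately have "(\<Union>a\<in>coset x. \<Union>b\<in>coset y. coset (a \<otimes>\<^bsub>M\<^esub> b)) = coset (x \<otimes>\<^bsub>M\<^esub> y)"
    by blast
  then show ?thesis
    by (simp add: quotient_module_def FactRing_def rcoset_mult_def)
qed

lemmas quotient_simps = quotient_zero quotient_add quotient_smult

lemma quotient_is_module: "module complex_field (quotient_module M H)"
proof (rule moduleI)
  show "abelian_group (quotient_module M H)"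
  proof (rule abelian_groupI)
    fix A assume "A \<in> carrier (quotient_module M H)"
    then obtain x where "x \<in> carrier M" "A = coset x"
      by (auto simp: quotient_carrier)
    then show "\<exists>B\<in>carrier (quotient_module M H).
        B \<oplus>\<^bsub>quotient_module M H\<^esub> A = \<zero>\<^bsub>quotient_module M H\<^esub>"
      using finsupp.subspace_neg[OF subspace_carrier, of x]
      by (intro bexI[of _ "coset (- x)"]) (auto simp: quotient_simps quotient_carrier)
  qed (use subspace_carrier in \<open>auto simp: quotient_carrier quotient_simps
         finsupp.subspace_def algebra_simps\<close>)
qed (use subspace_carrier in \<open>auto simp: cring_complex_field quotient_carrier quotient_simps
        finsupp.subspace_def finsupp.scale_left_distrib finsupp.scale_right_distrib\<close>)

lemma quotient_minus:
  assumes "x \<in> carrier M" "y \<in> carrier M"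
  shows "coset x \<ominus>\<^bsub>quotient_module M H\<^esub> coset y = coset (x - y)"
proof -
  interpret Q: Module.module complex_field "quotient_module M H"
    by (rule quotient_is_module)
  have "\<ominus>\<^bsub>quotient_module M H\<^esub> coset y = coset (- y)"
    using assms finsupp.subspace_neg[OF subspace_carrier]
    by (intro Q.minus_equality) (auto simp: quotient_simps quotient_carrier)
  then show ?thesis
    by (simp add: a_minus_def quotient_add)
qed

end

section \<open>The Virasoro algebra\<close>

lemma vir_bracket_eq_linear_extension:
  "vir_bracket x y = linear_extension (\<lambda>g. linear_extension (basis_bracket g) y) x"
  by (simp add: vir_bracket_def linear_extension_def finsupp.scale_sum_right)

lemma vir_bracket_add_left: "vir_bracket (x + x') y = vir_bracket x y + vir_bracket x' y"
  by (simp add: vir_bracket_eq_linear_extension linear_extension_add)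

lemma vir_bracket_add_right: "vir_bracket x (y + y') = vir_bracket x y + vir_bracket x y'"
  by (simp add: vir_bracket_eq_linear_extension linear_extension_add linear_extension_fun_add)

lemma vir_bracket_scale_left: "vir_bracket (scale a x) y = scale a (vir_bracket x y)"
  by (simp add: vir_bracket_eq_linear_extension linear_extension_scale)

lemma vir_bracket_scale_right: "vir_bracket x (scale a y) = scale a (vir_bracket x y)"
  by (simp add: vir_bracket_eq_linear_extension linear_extension_scale linear_extension_fun_scale)

lemmas vir_bracket_bilinear =
  vir_bracket_add_left vir_bracket_add_right vir_bracket_scale_left vir_bracket_scale_right

lemma vir_bracket_zero [simp]: "vir_bracket 0 y = 0" "vir_bracket x 0 = 0"
  by (simp_all add: vir_bracket_eq_linear_extension)

lemma vir_bracket_single: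
  "vir_bracket (Poly_Mapping.single g 1) (Poly_Mapping.single h 1) = basis_bracket g h"
  by (simp add: vir_bracket_eq_linear_extension)

lemma basis_bracket_antisym: "basis_bracket g h + basis_bracket h g = 0"
proof (cases g; cases h)
  fix i j assume "g = Gen i" "h = Gen j"
  then show ?thesis
    by (auto intro!: poly_mapping_eqI
        simp: lookup_add vir_d_def vir_c_def lookup_single when_def field_simps)
qed simp_all

lemma vir_bracket_antisym: "vir_bracket x y + vir_bracket y x = 0"
proof -
  have linear: "Vector_Spaces.linear scale scale (\<lambda>x. vir_bracket x y + vir_bracket y x)" for y
    by unfold_locales
      (simp_all add: vir_bracket_bilinear finsupp.scale_right_distrib algebra_simps)
  have basis: "vir_bracket x (Poly_Mapping.single h 1) + vir_bracket (Poly_Mapping.single h 1) x \<in> {0}"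
    for x h
    by (rule linear_mem_of_basis[OF linear])
      (simp_all add: vir_bracket_single basis_bracket_antisym)
  have "vir_bracket x y + vir_bracket y x \<in> {0}"
    by (rule linear_mem_of_basis[OF linear]) (use basis in \<open>simp_all add: add.commute\<close>)
  then show ?thesis by simp
qed

lemma vir_bracket_self: "vir_bracket x x = 0"
proof (rule poly_mapping_eqI)
  fix k
  show "Poly_Mapping.lookup (vir_bracket x x) k = Poly_Mapping.lookup 0 k"
    using arg_cong[OF vir_bracket_antisym[of x x], of "\<lambda>f. Poly_Mapping.lookup f k"]
    by (simp add: lookup_add)
qed

text \<open>The Jacobi identity is trilinear, and this expression is invariant under cyclic permutation;
  linearity in the first argument therefore suffices to reduce it to basis elements.\<close>

definition jacobiator where
  "jacobiator x y z =
    vir_bracket x (vir_bracket y z) + vir_bracket y (vir_bracket z x) + vir_bracket z (vir_bracket x y)"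

lemma linear_jacobiator: "Vector_Spaces.linear scale scale (\<lambda>x. jacobiator x y z)"
  by unfold_locales
    (simp_all add: jacobiator_def vir_bracket_bilinear finsupp.scale_right_distrib algebra_simps)

lemma jacobiator_cyclic: "jacobiator x y z = jacobiator y z x"
  by (simp add: jacobiator_def algebra_simps)

lemma basis_bracket_Central [simp]: "basis_bracket g Central = 0"
  by (cases g) simp_all

lemma vir_bracket_single_generators:
  "vir_bracket (Poly_Mapping.single g 1) (vir_d i) = basis_bracket g (Gen i)"
  "vir_bracket (Poly_Mapping.single g 1) vir_c = 0"
  by (simp_all add: vir_d_def vir_c_def vir_bracket_single)

lemma vir_bracket_single_scale_d:
  "vir_bracket (Poly_Mapping.single g 1) (basis_bracket (Gen i) (Gen j)) =
    scale (of_int (j - i)) (basis_bracket g (Gen (i + j)))"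
  by (simp add: vir_bracket_bilinear vir_bracket_single_generators)

lemma jacobiator_basis:
  "jacobiator (Poly_Mapping.single f 1) (Poly_Mapping.single g 1) (Poly_Mapping.single h 1) = 0"
proof (cases f; cases g; cases h)
  fix i j k assume eq: "f = Gen i" "g = Gen j" "h = Gen k"
  show ?thesis
  \<comment> \<open>Only in degree zero can the central element appear; there the identity is the cocycle condition for \<open>(i\<^sup>3 - i)/12\<close>.\<close>
  proof (cases "i + j + k = 0")
    case True
    then have k: "k = - i - j" by simp
    show ?thesis
      unfolding jacobiator_def eq vir_bracket_single vir_bracket_single_scale_d k
      by (rule poly_mapping_eqI)
        (simp add: lookup_add vir_d_def vir_c_def lookup_single when_def field_simps power3_eq_cube
          del: Poly_Mapping.map_single)
  next
    case False
    then have "i \<noteq> - (j + k)" "j \<noteq> - (k + i)" "k \<noteq> - (i + j)" "j + (k + i) = i + (j + k)" "k + (i + j) = i + (j + k)"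
      by auto
    then show ?thesis
      unfolding jacobiator_def eq vir_bracket_single vir_bracket_single_scale_d
      by (intro poly_mapping_eqI)
        (simp add: lookup_add vir_d_def lookup_single when_def algebra_simps
          del: Poly_Mapping.map_single)
  qed
qed (simp_all add: jacobiator_def vir_bracket_single vir_bracket_bilinear
      vir_bracket_single_generators)

lemma jacobiator_zero: "jacobiator x y z = 0"
proof -
  have *: "jacobiator x y z = 0"
    if "\<And>k. jacobiator (Poly_Mapping.single k 1) y z = 0" for x y z
    using linear_mem_of_basis[OF linear_jacobiator finsupp.subspace_single_0, of x y z] that by simp
  show ?thesis
    by (rule *, subst jacobiator_cyclic, rule *, subst jacobiator_cyclic, rule *)
      (rule jacobiator_basis)
qed

interpretation free: finsupp_module "free_space S" for S
  by unfold_locales (simp_all add: free_space_def subspace_supported)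

interpretation virasoro: finsupp_module virasoro
  by unfold_locales (simp_all add: virasoro_def free_space_def)

lemma virasoro_simps [simp]: "carrier virasoro = UNIV" "x \<otimes>\<^bsub>virasoro\<^esub> y = vir_bracket x y"
  by (simp_all add: virasoro_def free_space_def)

lemma lie_algebra_virasoro: "lie_algebra complex_field virasoro"
proof -
  interpret K: field complex_field by (rule field_complex_field)
  show ?thesis
    using jacobiator_zero
    by unfold_locales (simp_all add: vir_bracket_bilinear vir_bracket_self jacobiator_def)
qed

section \<open>The quotients of the nonnegative part\<close>

lemma carrier_virasoro_plus: "carrier virasoro_plus = {f. Poly_Mapping.keys f \<subseteq> Gen ` {0..}}"
proof -
  have "{vir_d i | i. i \<ge> 0} = {Poly_Mapping.single g 1 | g. g \<in> Gen ` {0..}}"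
    by (auto simp: vir_d_def)
  then show ?thesis
    by (simp add: virasoro_plus_def virasoro.module_span_eq span_singles)
qed

interpretation virasoro_plus: finsupp_module virasoro_plus
  by unfold_locales
    (simp_all only: carrier_virasoro_plus subspace_supported, simp_all add: virasoro_plus_def)

lemma virasoro_plus_mult [simp]: "x \<otimes>\<^bsub>virasoro_plus\<^esub> y = vir_bracket x y"
  by (simp add: virasoro_plus_def)

lemma keys_basis_bracket:
  assumes "i \<ge> 0" "j \<ge> 0"
  shows "Poly_Mapping.keys (basis_bracket (Gen i) (Gen j)) \<subseteq> {Gen (i + j)}"
  using assms by (auto simp: in_keys_iff lookup_add vir_d_def vir_c_def lookup_single when_def split: if_splits)

lemma vir_bracket_supported:
  assumes "p \<ge> 0" "q \<ge> 0" "Poly_Mapping.keys x \<subseteq> Gen ` {p..}" "Poly_Mapping.keys y \<subseteq> Gen ` {q..}"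
  shows "Poly_Mapping.keys (vir_bracket x y) \<subseteq> Gen ` {p + q..}"
proof -
  let ?H = "{f. Poly_Mapping.keys f \<subseteq> Gen ` {p + q..}}"
  have "vir_bracket x y \<in> ?H"
    unfolding vir_bracket_eq_linear_extension
  proof (intro linear_extension_mem subspace_supported)
    fix g h assume "g \<in> Poly_Mapping.keys x" "h \<in> Poly_Mapping.keys y"
    then obtain i j where "g = Gen i" "h = Gen j" "i \<ge> p" "j \<ge> q"
      using assms by blast
    then show "basis_bracket g h \<in> ?H"
      using assms keys_basis_bracket[of i j] by fastforce
  qed
  then show ?thesis by simp
qed

text \<open>The \<open>d\<^sub>i\<close> with \<open>i > r\<close> already span a subalgebra: indices add, and
  the sum of two positive indices is never zero, so the central element cannot arise.\<close>

lemma virasoro_ideal_eq: "virasoro_ideal r = {f. Poly_Mapping.keys f \<subseteq> Gen ` {int r + 1..}}"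
  unfolding virasoro_ideal_def lie_generated_def
proof (rule hull_unique)
  let ?I = "{f. Poly_Mapping.keys f \<subseteq> Gen ` {int r + 1..}} :: (virasoro_basis \<Rightarrow>\<^sub>0 complex) set"
  show "{vir_d i | i. i > int r} \<subseteq> ?I"
    by (auto simp: vir_d_def)
  have "vir_bracket x y \<in> ?I" if "x \<in> ?I" "y \<in> ?I" for x y
  proof -
    have "Poly_Mapping.keys (vir_bracket x y) \<subseteq> Gen ` {(int r + 1) + (int r + 1)..}"
      using that by (intro vir_bracket_supported) simp_all
    also have "\<dots> \<subseteq> Gen ` {int r + 1..}"
      by (intro image_mono) simp
    finally show ?thesis
      by simp
  qed
  then show "lie_subalgebra ?I complex_field virasoro"
    by (intro lie_subalgebra.intro lie_subalgebra_axioms.intro)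
      (simp_all add: virasoro.submodule_iff subspace_supported)
  show "?I \<subseteq> H" if H: "{vir_d i | i. i > int r} \<subseteq> H" "lie_subalgebra H complex_field virasoro" for H
  proof
    fix f assume f: "f \<in> ?I"
    have "finsupp.subspace H"
      using H(2) by (simp add: lie_subalgebra_def virasoro.submodule_iff)
    then show "f \<in> H"
    proof (rule subspace_mem_of_basis)
      fix g assume "g \<in> Poly_Mapping.keys f"
      then obtain i where "g = Gen i" "i > int r"
        using f by force
      then show "Poly_Mapping.single g 1 \<in> H"
        using H(1) by (auto simp: vir_d_def)
    qed
  qed
qed

interpretation a_algebra: finsupp_quotient virasoro_plus "virasoro_ideal r" for r
  by unfold_locales (auto simp: virasoro_ideal_eq subspace_supported carrier_virasoro_plus)

lemma virasoro_ideal_absorbs: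
  assumes "x \<in> virasoro_ideal r" "y \<in> carrier virasoro_plus"
  shows "vir_bracket x y \<in> virasoro_ideal r" "vir_bracket y x \<in> virasoro_ideal r"
  using vir_bracket_supported[of "int r + 1" 0 x y] vir_bracket_supported[of 0 "int r + 1" y x] assms
  by (simp_all add: virasoro_ideal_eq carrier_virasoro_plus)

text \<open>Ideals absorb brackets, so the bracket of cosets can be computed on any representatives.\<close>

lemma a_algebra_bracket:
  assumes "x \<in> carrier virasoro_plus" "y \<in> carrier virasoro_plus"
  shows "a_algebra.coset r x \<otimes>\<^bsub>a_algebra r\<^esub> a_algebra.coset r y =
    a_algebra.coset r (vir_bracket x y)"
proof -
  have "vir_bracket a b - vir_bracket x y \<in> virasoro_ideal r"
    if "a - x \<in> virasoro_ideal r" "b - y \<in> virasoro_ideal r" for a b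
  proof -
    have "vir_bracket a b - vir_bracket x y = vir_bracket (a - x) (y + (b - y)) + vir_bracket x (b - y)"
      using vir_bracket_add_left[of "a - x" x b] vir_bracket_add_right[of x "b - y" y] by simp
    moreover have "y + (b - y) \<in> carrier virasoro_plus"
      using that(2) assms(2) a_algebra.H_carrier[of r]
      by (intro finsupp.subspace_add virasoro_plus.subspace_carrier) auto
    ultimately show ?thesis
      using that(1) virasoro_ideal_absorbs(1)[of "a - x" r "y + (b - y)"]
        virasoro_ideal_absorbs(2)[OF that(2) assms(1)]
      by (simp add: finsupp.subspace_add a_algebra.subspace_H)
  qed
  then show ?thesis
    using a_algebra.quotient_mult[of x r y] by (simp add: a_algebra_def)
qed

section \<open>The exponential generating vectors\<close>

text \<open>Apart from the scalar \<open>\<alpha> + n\<close>, this is what \<open>d\<^sub>m\<close> applies to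
  \<open>v\<close> in \<open>v \<otimes> t\<^sup>n\<close>: the truncation of an exponential
  generating series in \<open>m\<close>, whence the role of the binomial theorem.\<close>

definition generating_vector :: "nat \<Rightarrow> int \<Rightarrow> (virasoro_basis \<Rightarrow>\<^sub>0 complex)"
  where "generating_vector r m = (\<Sum>i\<in>{0..r}. scale (of_int m ^ (i + 1) / fact (i + 1)) (vir_d (int i)))"

lemma generating_vector_carrier: "generating_vector r m \<in> carrier virasoro_plus"
  unfolding generating_vector_def
  by (intro finsupp.subspace_sum finsupp.subspace_scale virasoro_plus.subspace_carrier)
    (auto simp: carrier_virasoro_plus vir_d_def)

lemma vir_bracket_sum_left: "vir_bracket (\<Sum>i\<in>A. f i) y = (\<Sum>i\<in>A. vir_bracket (f i) y)"
  by (induction A rule: infinite_finite_induct) (simp_all add: vir_bracket_bilinear)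

lemma vir_bracket_sum_right: "vir_bracket x (\<Sum>i\<in>A. f i) = (\<Sum>i\<in>A. vir_bracket x (f i))"
  by (induction A rule: infinite_finite_induct) (simp_all add: vir_bracket_bilinear)

lemma lookup_generating_vector:
  "s \<le> r \<Longrightarrow> Poly_Mapping.lookup (generating_vector r m) (Gen (int s)) = of_int m ^ (s + 1) / fact (s + 1)"
  by (simp add: generating_vector_def lookup_sum vir_d_def lookup_single when_def sum.delta if_distrib
      cong: if_cong)

lemma binomial_exponential:
  "(\<Sum>i\<le>n. x ^ i / fact i * (y ^ (n - i) / fact (n - i))) = (x + y) ^ n / fact n" for x y :: complex
proof -
  have "(x + y) ^ n / fact n = (\<Sum>i\<le>n. of_nat (n choose i) * x ^ i * y ^ (n - i) / fact n)"
    by (simp add: binomial_ring sum_divide_distrib)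
  also have "\<dots> = (\<Sum>i\<le>n. x ^ i / fact i * (y ^ (n - i) / fact (n - i)))"
    by (intro sum.cong) (auto simp: binomial_fact field_simps)
  finally show ?thesis by simp
qed

text \<open>The factor \<open>i\<close> cancels against \<open>i!\<close>, which leaves \<open>x\<close> times
  the coefficient of one degree less.\<close>

lemma binomial_exponential_weighted:
  fixes x y :: complex
  shows "(\<Sum>i\<le>Suc n. x ^ i / fact i * (y ^ (Suc n - i) / fact (Suc n - i)) * of_nat i) =
    x * (x + y) ^ n / fact n"
proof -
  have "(\<Sum>i\<le>Suc n. x ^ i / fact i * (y ^ (Suc n - i) / fact (Suc n - i)) * of_nat i) =
      (\<Sum>i\<le>n. x ^ Suc i / fact (Suc i) * (y ^ (n - i) / fact (n - i)) * of_nat (Suc i))"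
    by (subst sum.atMost_Suc_shift) (simp del: fact_Suc of_nat_Suc)
  also have "\<dots> = (\<Sum>i\<le>n. x * (x ^ i / fact i * (y ^ (n - i) / fact (n - i))))"
    by (intro sum.cong refl) (simp add: fact_Suc field_simps del: of_nat_Suc)
  also have "\<dots> = x * (x + y) ^ n / fact n"
    unfolding sum_distrib_left[symmetric] binomial_exponential by simp
  finally show ?thesis .
qed

text \<open>Shifting both exponents by one turns the left side into the sum of \<open>x\<^sup>a y\<^sup>b (b -
  a)/(a! b!)\<close> over \<open>a + b = s + 2\<close> without its boundary terms at \<open>a =
  0\<close> and \<open>b = 0\<close>; these are the last two terms on the right.\<close>

lemma bracket_coefficient:
  fixes x y :: complex
  shows "(\<Sum>i\<le>s. x ^ Suc i / fact (Suc i) * (y ^ Suc (s - i) / fact (Suc (s - i))) * (of_nat (s - i) - of_nat i)) =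
    (y - x) * (x + y) ^ Suc s / fact (Suc s) - y * y ^ Suc s / fact (Suc s) + x * x ^ Suc s / fact (Suc s)"
proof -
  let ?g = "\<lambda>a. x ^ a / fact a * (y ^ (Suc (Suc s) - a) / fact (Suc (Suc s) - a)) * (of_nat (Suc (Suc s) - a) - of_nat a)"
  \<comment> \<open>The mirror image of the weighted identity, obtained by reversing the order of summation.\<close>
  have weighted: "(\<Sum>i\<le>Suc n. x ^ i / fact i * (y ^ (Suc n - i) / fact (Suc n - i)) * of_nat (Suc n - i)) =
    y * (x + y) ^ n / fact n" for n
    using binomial_exponential_weighted[of y x n]
    by (subst sum.nat_diff_reindex[symmetric, of _ "Suc (Suc n)", unfolded lessThan_Suc_atMost])
      (simp add: algebra_simps)
  have absorb: "z ^ Suc k / fact (Suc k) * of_nat (Suc k) = z * z ^ k / fact k" for z :: complex and k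
    by (simp add: fact_Suc del: of_nat_Suc)
  have "(\<Sum>a\<le>Suc (Suc s). ?g a) = (y - x) * (x + y) ^ Suc s / fact (Suc s)"
    unfolding right_diff_distrib sum_subtractf weighted binomial_exponential_weighted
    by (simp add: diff_divide_distrib left_diff_distrib)
  moreover have "(\<Sum>a\<le>Suc (Suc s). ?g a) = ?g 0 + (\<Sum>i\<le>s. ?g (Suc i)) + ?g (Suc (Suc s))"
    by (simp only: sum.atMost_Suc_shift[of _ "Suc s"] sum.atMost_Suc[of _ s] add.assoc)
  moreover have "?g 0 = y * y ^ Suc s / fact (Suc s)"
    using absorb[of y "Suc s"] by (simp del: fact_Suc power_Suc of_nat_Suc)
  moreover have "?g (Suc (Suc s)) = - (x * x ^ Suc s / fact (Suc s))"
    using absorb[of x "Suc s"] by (simp del: fact_Suc power_Suc of_nat_Suc)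
  moreover have "(\<Sum>i\<le>s. ?g (Suc i)) =
      (\<Sum>i\<le>s. x ^ Suc i / fact (Suc i) * (y ^ Suc (s - i) / fact (Suc (s - i))) * (of_nat (s - i) - of_nat i))"
    by (intro sum.cong refl) (simp add: Suc_diff_le)
  ultimately show ?thesis by simp
qed

text \<open>The difference lies in the nonnegative part, so it is in the ideal as soon as its coefficients at
  the \<open>d\<^sub>s\<close> with \<open>s \<le> r\<close> vanish.\<close>

lemma generating_vector_bracket:
  "vir_bracket (generating_vector r m) (generating_vector r n)
    + scale (of_int n) (generating_vector r n)
    - (scale (of_int (n - m)) (generating_vector r (m + n)) + scale (of_int m) (generating_vector r m))
    \<in> virasoro_ideal r" (is "?x \<in> _")
proof -
  let ?c = "\<lambda>m i. of_int m ^ (i + 1) / fact (i + 1) :: complex"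
  have carrier: "?x \<in> carrier virasoro_plus"
    using vir_bracket_supported[of 0 0 "generating_vector r m" "generating_vector r n"]
      generating_vector_carrier
    by (intro finsupp.subspace_add finsupp.subspace_diff finsupp.subspace_scale
        virasoro_plus.subspace_carrier) (auto simp: carrier_virasoro_plus)
  have zero: "Poly_Mapping.lookup ?x (Gen (int s)) = 0" if "s \<le> r" for s
  proof -
    have basis: "Poly_Mapping.lookup (vir_bracket (vir_d (int i)) (vir_d (int j))) (Gen (int s)) =
        (if i + j = s then of_nat j - of_nat i else 0)" for i j
      by (auto simp: vir_d_def vir_bracket_single vir_c_def lookup_add lookup_single when_def)
    have "Poly_Mapping.lookup (vir_bracket (generating_vector r m) (generating_vector r n)) (Gen (int s)) =
        (\<Sum>i\<in>{0..r}. \<Sum>j\<in>{0..r}. ?c m i * ?c n j * (if i + j = s then of_nat j - of_nat i else 0))"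
      unfolding generating_vector_def vir_bracket_sum_left
      by (simp add: vir_bracket_sum_right vir_bracket_scale_left vir_bracket_scale_right
          lookup_sum basis mult_ac sum_distrib_left del: fact_Suc power_Suc)
    also have "\<dots> = (\<Sum>i\<le>s. ?c m i * ?c n (s - i) * (of_nat (s - i) - of_nat i))"
    proof -
      have "(\<Sum>j\<in>{0..r}. ?c m i * ?c n j * (if i + j = s then of_nat j - of_nat i else 0)) =
          (if i \<le> s then ?c m i * ?c n (s - i) * (of_nat (s - i) - of_nat i) else 0)" for i
      proof -
        have "(\<Sum>j\<in>{0..r}. ?c m i * ?c n j * (if i + j = s then of_nat j - of_nat i else 0)) =
            (\<Sum>j\<in>{0..r}. if j = s - i then (if i \<le> s then ?c m i * ?c n (s - i) * (of_nat (s - i) - of_nat i) else 0) else 0)"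
          by (intro sum.cong) auto
        moreover have "s - i \<in> {0..r}"
          using that by simp
        ultimately show ?thesis
          by (simp only: sum.delta finite_atLeastAtMost if_True)
      qed
      then have "(\<Sum>i\<in>{0..r}. \<Sum>j\<in>{0..r}. ?c m i * ?c n j * (if i + j = s then of_nat j - of_nat i else 0)) =
          (\<Sum>i\<in>{0..r}. if i \<le> s then ?c m i * ?c n (s - i) * (of_nat (s - i) - of_nat i) else 0)"
        by (simp only:)
      also have "\<dots> = (\<Sum>i\<le>s. ?c m i * ?c n (s - i) * (of_nat (s - i) - of_nat i))"
        using that by (intro sum.mono_neutral_cong_right) auto
      finally show ?thesis .
    qed
    also have "\<dots> = of_int (n - m) * ?c (m + n) s - of_int n * ?c n s + of_int m * ?c m s"
      using bracket_coefficient[of "of_int m" "of_int n" s] by simp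
    finally show ?thesis
      using that by (simp add: lookup_add lookup_minus lookup_generating_vector del: fact_Suc power_Suc)
  qed
  have "g \<in> Gen ` {int r + 1..}" if g: "g \<in> Poly_Mapping.keys ?x" for g
  proof -
    obtain i where i: "g = Gen i" "i \<ge> 0"
      using carrier g unfolding carrier_virasoro_plus by blast
    have "\<not> nat i \<le> r"
    proof
      assume "nat i \<le> r"
      then have "Poly_Mapping.lookup ?x (Gen i) = 0"
        using zero[of "nat i"] i(2) by (simp only: int_nat_eq if_True)
      then show False
        using g i(1) unfolding in_keys_iff by blast
    qed
    then show ?thesis
      using i by simp
  qed
  then show ?thesis
    unfolding virasoro_ideal_eq by blast
qed

section \<open>Tensor products\<close>

lemma free_space_carrier [simp]: "carrier (free_space S) = {f. Poly_Mapping.keys f \<subseteq> S}"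
  by (simp add: free_space_def)

locale tensor_product =
  fixes V :: "(complex, 'a, 'c) module_scheme" and W :: "(complex, 'b, 'd) module_scheme"
  assumes V: "Module.module complex_field V" and W: "Module.module complex_field W"
begin

sublocale V: Module.module complex_field V by (rule V)
sublocale W: Module.module complex_field W by (rule W)

abbreviation basis_tensor :: "'a \<Rightarrow> 'b \<Rightarrow> ('a \<times> 'b \<Rightarrow>\<^sub>0 complex)"
  where "basis_tensor v w \<equiv> Poly_Mapping.single (v, w) 1"

lemma basis_tensor_carrier:
  "v \<in> carrier V \<Longrightarrow> w \<in> carrier W \<Longrightarrow> basis_tensor v w \<in> carrier (free_space (carrier V \<times> carrier W))"
  by simp

lemma tensor_relations_carrier: "tensor_relations V W \<subseteq> carrier (free_space (carrier V \<times> carrier W))"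
proof -
  have smult: "scale a (basis_tensor v w) \<in> carrier (free_space (carrier V \<times> carrier W))"
    if "v \<in> carrier V" "w \<in> carrier W" for a v w
    using that by (intro finsupp.subspace_scale free.subspace_carrier basis_tensor_carrier)
  show ?thesis
    unfolding tensor_relations_def Let_def
    by (intro Un_least subsetI; clarsimp simp del: Poly_Mapping.map_single free_space_carrier;
        intro finsupp.subspace_diff free.subspace_carrier basis_tensor_carrier smult;
        simp)
qed

text \<open>As a linear span the kernel can be mapped forward by linear maps: it is preserved once the defining
  relations are.\<close>

lemma tensor_kernel_eq: "tensor_kernel V W = finsupp.span (tensor_relations V W)"
  using tensor_relations_carrier by (simp add: tensor_kernel_def free.module_span_eq del: free_space_carrier)

sublocale T: finsupp_quotient "free_space (carrier V \<times> carrier W)" "tensor_kernel V W"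
  by unfold_locales
    (use tensor_relations_carrier in \<open>simp_all add: tensor_kernel_eq finsupp.span_minimal
      free.subspace_carrier del: free_space_carrier\<close>)

lemma pure_tensor_eq: "pure_tensor V W v w = T.coset (basis_tensor v w)"
  by (simp add: pure_tensor_def)

lemma relation_in_kernel: "x \<in> tensor_relations V W \<Longrightarrow> x \<in> tensor_kernel V W"
  by (simp add: tensor_kernel_eq finsupp.span_base)

lemma basis_tensor_add_left:
  assumes "u \<in> carrier V" "v \<in> carrier V" "w \<in> carrier W"
  shows "basis_tensor (u \<oplus>\<^bsub>V\<^esub> v) w - basis_tensor u w - basis_tensor v w \<in> tensor_kernel V W"
  by (rule relation_in_kernel) (use assms in \<open>unfold tensor_relations_def Let_def, blast\<close>)

lemma basis_tensor_add_right:
  assumes "v \<in> carrier V" "w \<in> carrier W" "z \<in> carrier W"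
  shows "basis_tensor v (w \<oplus>\<^bsub>W\<^esub> z) - basis_tensor v w - basis_tensor v z \<in> tensor_kernel V W"
  by (rule relation_in_kernel) (use assms in \<open>unfold tensor_relations_def Let_def, blast\<close>)

lemma basis_tensor_smult_left:
  assumes "v \<in> carrier V" "w \<in> carrier W"
  shows "basis_tensor (a \<odot>\<^bsub>V\<^esub> v) w - scale a (basis_tensor v w) \<in> tensor_kernel V W"
  by (rule relation_in_kernel) (use assms in \<open>unfold tensor_relations_def Let_def, blast\<close>)

lemma basis_tensor_smult_right:
  assumes "v \<in> carrier V" "w \<in> carrier W"
  shows "basis_tensor v (a \<odot>\<^bsub>W\<^esub> w) - scale a (basis_tensor v w) \<in> tensor_kernel V W"
  by (rule relation_in_kernel) (use assms in \<open>unfold tensor_relations_def Let_def, blast\<close>)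

end

lemma laurent_simps [simp]: "carrier laurent = UNIV" "add laurent = (+)" "module.smult laurent = scale"
  "\<zero>\<^bsub>laurent\<^esub> = 0"
  by (simp_all add: laurent_def free_space_def)

interpretation laurent: finsupp_module laurent
  by unfold_locales simp_all

locale loop_module = tensor_product M laurent
  for M :: "(complex, 'm, 'x) module_scheme" (structure)
begin

text \<open>A pair \<open>(v, w)\<close> is additive and homogeneous in \<open>w\<close> modulo the kernel, so
  it can be expanded in powers of \<open>t\<close>.\<close>

lemma free_space_spanned:
  assumes "f \<in> carrier (free_space (carrier M \<times> carrier laurent))"
  shows "f \<in> finsupp.span (tensor_kernel M laurent \<union> {basis_tensor v (t_power n) | v n. v \<in> carrier M})"
    (is "f \<in> finsupp.span ?S")
proof (rule subspace_mem_of_basis[OF finsupp.subspace_span])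
  fix k assume "k \<in> Poly_Mapping.keys f"
  then obtain v w where k: "k = (v, w)" "v \<in> carrier M"
    using assms by (cases k) auto
  have kernel: "x \<in> finsupp.span ?S" if "x \<in> tensor_kernel M laurent" for x
    using that by (simp add: finsupp.span_base)
  have add: "basis_tensor v (x + y) \<in> finsupp.span ?S"
    if "basis_tensor v x \<in> finsupp.span ?S" "basis_tensor v y \<in> finsupp.span ?S" for x y
  proof -
    have "basis_tensor v (x + y) - basis_tensor v x - basis_tensor v y \<in> finsupp.span ?S"
      using basis_tensor_add_right[OF k(2), of x y] by (intro kernel) simp
    then have "(basis_tensor v (x + y) - basis_tensor v x - basis_tensor v y)
        + basis_tensor v x + basis_tensor v y \<in> finsupp.span ?S"
      using that by (intro finsupp.span_add)
    then show ?thesis by simp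
  qed
  have smult: "basis_tensor v (scale a x) \<in> finsupp.span ?S"
    if "basis_tensor v x \<in> finsupp.span ?S" for a x
  proof -
    have "basis_tensor v (scale a x) - scale a (basis_tensor v x) \<in> finsupp.span ?S"
      using basis_tensor_smult_right[OF k(2), of x a] by (intro kernel) simp
    then have "(basis_tensor v (scale a x) - scale a (basis_tensor v x))
        + scale a (basis_tensor v x) \<in> finsupp.span ?S"
      using that by (intro finsupp.span_add finsupp.span_scale)
    then show ?thesis by simp
  qed
  have base: "basis_tensor v (Poly_Mapping.single n 1) \<in> finsupp.span ?S" for n
    by (rule finsupp.span_base) (use k(2) in \<open>auto simp: t_power_def\<close>)
  have "w \<in> {x. basis_tensor v x \<in> finsupp.span ?S}"
  proof (rule subspace_mem_of_basis[OF finsupp.subspaceI])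
    \<comment> \<open>The pair \<open>(v, 0)\<close> is not the zero function; it is reached as the scalar multiple by zero of a pair in the span.\<close>
    have "basis_tensor v (scale 0 (Poly_Mapping.single 0 1)) \<in> finsupp.span ?S"
      by (intro smult base)
    then show "0 \<in> {x. basis_tensor v x \<in> finsupp.span ?S}"
      by simp
  qed (use add smult base in blast)+
  then show "Poly_Mapping.single k 1 \<in> finsupp.span ?S"
    by (simp add: k(1))
qed

end

section \<open>The action on the tensor product with Laurent polynomials\<close>

locale virasoro_action =
  fixes r :: nat and M :: "(complex, 'm, 'x) module_scheme" (structure)
    and \<rho> :: "(virasoro_basis \<Rightarrow>\<^sub>0 complex) set \<Rightarrow> 'm \<Rightarrow> 'm" and \<alpha> :: complex
  assumes lie: "lie_module complex_field (a_algebra r) M \<rho>"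
begin

sublocale R: lie_module complex_field "a_algebra r" M \<rho>
  by (rule lie)

sublocale loop_module M
  by (intro loop_module.intro tensor_product.intro R.M.module_axioms laurent.is_module)

text \<open>The action of \<open>\<aa>\<^sub>r\<close> pulled back to the nonnegative part of the Virasoro
  algebra. Linear combinations of the generators are thereby formed in a type with addition instead of
  inside the module record.\<close>

definition plus_action :: "(virasoro_basis \<Rightarrow>\<^sub>0 complex) \<Rightarrow> 'm \<Rightarrow> 'm"
  where "plus_action x v = \<rho> (a_algebra.coset r x) v"

lemma coset_carrier: "x \<in> carrier virasoro_plus \<Longrightarrow> a_algebra.coset r x \<in> carrier (a_algebra r)"
  by (simp add: a_algebra_def a_algebra.quotient_carrier)

lemma plus_action_closed [simp]:
  "x \<in> carrier virasoro_plus \<Longrightarrow> v \<in> carrier M \<Longrightarrow> plus_action x v \<in> carrier M"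
  by (simp add: plus_action_def R.act_closed coset_carrier)

lemma plus_action_add_left:
  assumes "x \<in> carrier virasoro_plus" "y \<in> carrier virasoro_plus" "v \<in> carrier M"
  shows "plus_action (x + y) v = plus_action x v \<oplus> plus_action y v"
  using R.act_add_left[OF assms(1,2)[THEN coset_carrier] assms(3)]
  unfolding plus_action_def a_algebra_def a_algebra.quotient_add .

lemma plus_action_scale_left:
  assumes "x \<in> carrier virasoro_plus" "v \<in> carrier M"
  shows "plus_action (scale a x) v = a \<odot> plus_action x v"
  using R.act_smult_left[OF _ assms(1)[THEN coset_carrier] assms(2), of a]
  unfolding plus_action_def a_algebra_def a_algebra.quotient_smult by simp

lemma plus_action_add_right:
  assumes "x \<in> carrier virasoro_plus" "v \<in> carrier M" "w \<in> carrier M"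
  shows "plus_action x (v \<oplus> w) = plus_action x v \<oplus> plus_action x w"
  using R.act_add_right[OF assms(1)[THEN coset_carrier] assms(2,3)]
  by (simp add: plus_action_def)

lemma plus_action_scale_right:
  assumes "x \<in> carrier virasoro_plus" "v \<in> carrier M"
  shows "plus_action x (a \<odot> v) = a \<odot> plus_action x v"
  using R.act_smult_right[OF _ assms(1)[THEN coset_carrier] assms(2), of a]
  by (simp add: plus_action_def)

lemma plus_action_bracket:
  assumes "x \<in> carrier virasoro_plus" "y \<in> carrier virasoro_plus" "v \<in> carrier M"
  shows "plus_action (vir_bracket x y) v =
    plus_action x (plus_action y v) \<ominus> plus_action y (plus_action x v)"
  using R.act_bracket[OF assms(1,2)[THEN coset_carrier] assms(3)]
  by (simp add: plus_action_def a_algebra_bracket assms)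

lemma plus_action_cong:
  assumes "x - y \<in> virasoro_ideal r"
  shows "plus_action x v = plus_action y v"
proof -
  have "a_algebra.coset r x = a_algebra.coset r y"
    using assms by (simp only: a_algebra.coset_eq_iff)
  then show ?thesis
    by (simp only: plus_action_def)
qed

lemma smult_zero: "v \<in> carrier M \<Longrightarrow> 0 \<odot> v = \<zero>"
  using R.M.smult_l_null by simp

lemma plus_action_sum:
  assumes "finite A" "\<And>i. i \<in> A \<Longrightarrow> x i \<in> carrier virasoro_plus" "v \<in> carrier M"
  shows "plus_action (\<Sum>i\<in>A. scale (c i) (x i)) v = (\<Oplus>i\<in>A. c i \<odot> plus_action (x i) v)"
  using assms(1,2)
proof (induction A rule: finite_induct)
  case empty
  have "plus_action (scale 0 0) v = 0 \<odot> plus_action 0 v"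
    using assms(3) finsupp.subspace_0[OF virasoro_plus.subspace_carrier]
    by (intro plus_action_scale_left)
  then show ?case
    using assms(3) finsupp.subspace_0[OF virasoro_plus.subspace_carrier] by (simp add: smult_zero)
next
  case (insert i A)
  have "scale (c j) (x j) \<in> carrier virasoro_plus" if "j \<in> insert i A" for j
    using insert.prems that by (intro finsupp.subspace_scale virasoro_plus.subspace_carrier)
  then have "plus_action (\<Sum>j\<in>insert i A. scale (c j) (x j)) v =
      plus_action (scale (c i) (x i)) v \<oplus> plus_action (\<Sum>j\<in>A. scale (c j) (x j)) v"
    using insert.hyps assms(3)
    by (simp add: plus_action_add_left finsupp.subspace_sum virasoro_plus.subspace_carrier)
  also have "\<dots> = c i \<odot> plus_action (x i) v \<oplus> (\<Oplus>i\<in>A. c i \<odot> plus_action (x i) v)"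
    using insert assms(3) by (simp add: plus_action_scale_left)
  also have "\<dots> = (\<Oplus>i\<in>insert i A. c i \<odot> plus_action (x i) v)"
    using insert assms(3) by (subst R.M.finsum_insert) auto
  finally show ?case .
qed

abbreviation exp_action :: "int \<Rightarrow> 'm \<Rightarrow> 'm"
  where "exp_action m \<equiv> plus_action (generating_vector r m)"

lemma exp_action_eq:
  assumes "v \<in> carrier M"
  shows "exp_action m v = (\<Oplus>i\<in>{0..r}. (of_int m ^ (i + 1) / fact (i + 1)) \<odot> \<rho> (d_bar r (int i)) v)"
proof -
  have "vir_d (int i) \<in> carrier virasoro_plus" for i
    by (auto simp: carrier_virasoro_plus vir_d_def)
  then show ?thesis
    unfolding generating_vector_def using assms by (subst plus_action_sum) (simp_all add: plus_action_def d_bar_def)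
qed

text \<open>The relation for the generating vectors applied to \<open>v\<close>, with the subtracted terms moved
  to the other side.\<close>

lemma exp_action_commutation:
  assumes v: "v \<in> carrier M"
  shows "of_int n \<odot> exp_action n v \<oplus> exp_action m (exp_action n v) =
    of_int (n - m) \<odot> exp_action (m + n) v \<oplus> of_int m \<odot> exp_action m v \<oplus> exp_action n (exp_action m v)"
proof -
  note carrier = generating_vector_carrier
  have bracket: "vir_bracket (generating_vector r m) (generating_vector r n) \<in> carrier virasoro_plus"
    using vir_bracket_supported[of 0 0] carrier by (simp add: carrier_virasoro_plus)
  have scale: "scale a (generating_vector r k) \<in> carrier virasoro_plus" for a k
    by (intro finsupp.subspace_scale virasoro_plus.subspace_carrier carrier)
  let ?x = "exp_action m (exp_action n v)" and ?y = "exp_action n (exp_action m v)"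
  have "(?x \<ominus> ?y) \<oplus> of_int n \<odot> exp_action n v =
      of_int (n - m) \<odot> exp_action (m + n) v \<oplus> of_int m \<odot> exp_action m v"
    using plus_action_cong[OF generating_vector_bracket[of r m n], of v] v
    by (simp add: plus_action_add_left plus_action_scale_left plus_action_bracket carrier bracket scale
        del: of_int_diff)
  moreover have "of_int n \<odot> exp_action n v \<oplus> ?x = ((?x \<ominus> ?y) \<oplus> of_int n \<odot> exp_action n v) \<oplus> ?y"
  proof -
    have "((?x \<ominus> ?y) \<oplus> of_int n \<odot> exp_action n v) \<oplus> ?y =
        of_int n \<odot> exp_action n v \<oplus> ?x \<oplus> (\<ominus> ?y \<oplus> ?y)"
      using v carrier by (simp add: a_minus_def R.M.a_ac)
    then show ?thesis
      using v carrier by (simp add: R.M.l_neg)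
  qed
  ultimately show ?thesis by (simp only:)
qed

definition weight_action :: "int \<Rightarrow> int \<Rightarrow> 'm \<Rightarrow> 'm"
  where "weight_action m n v = (\<alpha> + of_int n) \<odot> v \<oplus> exp_action m v"

lemma weight_action_closed [simp]: "v \<in> carrier M \<Longrightarrow> weight_action m n v \<in> carrier M"
  by (simp add: weight_action_def generating_vector_carrier)

lemma weight_action_add:
  assumes "v \<in> carrier M" "w \<in> carrier M"
  shows "weight_action m n (v \<oplus> w) = weight_action m n v \<oplus> weight_action m n w"
  using assms generating_vector_carrier
  by (simp add: weight_action_def plus_action_add_right R.M.smult_r_distr R.M.a_ac)

lemma weight_action_smult:
  assumes "v \<in> carrier M"
  shows "weight_action m n (a \<odot> v) = a \<odot> weight_action m n v"
  using assms generating_vector_carrier R.M.smult_assoc1[of "\<alpha> + of_int n" a v]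
    R.M.smult_assoc1[of a "\<alpha> + of_int n" v]
  by (simp add: weight_action_def plus_action_scale_right R.M.smult_r_distr mult.commute)

text \<open>This is the relation \<open>d\<^sub>m d\<^sub>n = (n - m) d\<^sub>m\<^sub>+\<^sub>n + d\<^sub>n
  d\<^sub>m\<close> evaluated at \<open>v \<otimes> t\<^sup>k\<close>.\<close>

lemma weight_action_commutation:
  assumes v: "v \<in> carrier M"
  shows "weight_action m (n + k) (weight_action n k v) =
    of_int (n - m) \<odot> weight_action (m + n) k v \<oplus> weight_action n (m + k) (weight_action m k v)"
proof -
  define b where "b = \<alpha> + of_int k"
  define u where "u = exp_action m v"
  define w where "w = exp_action n v"
  define p where "p = exp_action (m + n) v"
  note defs = b_def u_def w_def p_def
  have carrier: "u \<in> carrier M" "w \<in> carrier M" "p \<in> carrier M"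
    "exp_action m w \<in> carrier M" "exp_action n u \<in> carrier M"
    using v by (simp_all add: defs generating_vector_carrier)
  have commute: "of_int n \<odot> w \<oplus> exp_action m w = of_int (n - m) \<odot> p \<oplus> of_int m \<odot> u \<oplus> exp_action n u"
    using exp_action_commutation[OF v] by (simp add: defs)
  \<comment> \<open>With \<open>x = exp_action i v\<close> the last bracket is one side of the commutation relation; the terms before it are symmetric in \<open>i\<close> and \<open>j\<close> except for the coefficient of \<open>v\<close>.\<close>
  have expand: "(b + of_int i) \<odot> (b \<odot> v \<oplus> x) \<oplus> exp_action j (b \<odot> v \<oplus> x) =
      ((b + of_int i) * b) \<odot> v \<oplus> b \<odot> x \<oplus> b \<odot> exp_action j v \<oplus> (of_int i \<odot> x \<oplus> exp_action j x)"
    if "x \<in> carrier M" for i j x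
    using that v generating_vector_carrier R.M.smult_l_distr[of b "of_int i" x]
    by (simp add: R.M.smult_r_distr plus_action_add_right plus_action_scale_right
        R.M.smult_assoc1[symmetric, simplified] R.M.a_ac)
  have "weight_action m (n + k) (weight_action n k v) =
      ((b + of_int n) * b) \<odot> v \<oplus> b \<odot> w \<oplus> b \<odot> u \<oplus> (of_int n \<odot> w \<oplus> exp_action m w)"
    using expand[OF carrier(2), of n m] by (simp add: weight_action_def defs algebra_simps)
  also have "\<dots> = ((b + of_int m) * b) \<odot> v \<oplus> (of_int (n - m) * b) \<odot> v \<oplus> b \<odot> w \<oplus> b \<odot> u
      \<oplus> (of_int (n - m) \<odot> p \<oplus> of_int m \<odot> u \<oplus> exp_action n u)"
  proof -
    have "(b + of_int n) * b = (b + of_int m) * b + of_int (n - m) * b"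
      by (simp add: algebra_simps)
    then show ?thesis
      using v R.M.smult_l_distr[of "(b + of_int m) * b" "of_int (n - m) * b" v] commute by simp
  qed
  also have "\<dots> = of_int (n - m) \<odot> (b \<odot> v \<oplus> p) \<oplus>
      (((b + of_int m) * b) \<odot> v \<oplus> b \<odot> u \<oplus> b \<odot> w \<oplus> (of_int m \<odot> u \<oplus> exp_action n u))"
    using v carrier R.M.smult_assoc1[of "of_int (n - m)" b v]
    by (simp add: R.M.smult_r_distr R.M.a_ac del: of_int_diff)
  also have "\<dots> = of_int (n - m) \<odot> weight_action (m + n) k v \<oplus> weight_action n (m + k) (weight_action m k v)"
    using expand[OF carrier(1), of m n] by (simp add: weight_action_def defs algebra_simps)
  finally show ?thesis .
qed

text \<open>Linearity in the Laurent polynomial is built in exactly, that is, before passing to the quotient. Of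
  the tensor relations only those in the first factor then depend on properties of the module.\<close>

definition basis_action ::
    "virasoro_basis \<Rightarrow> 'm \<times> (int \<Rightarrow>\<^sub>0 complex) \<Rightarrow> ('m \<times> (int \<Rightarrow>\<^sub>0 complex) \<Rightarrow>\<^sub>0 complex)"
  where "basis_action g p =
    (case g of Central \<Rightarrow> 0
     | Gen m \<Rightarrow> linear_extension (\<lambda>n. basis_tensor (weight_action m n (fst p)) (t_power (n + m))) (snd p))"

lemma basis_action_Central [simp]: "basis_action Central = (\<lambda>_. 0)"
  by (simp add: basis_action_def fun_eq_iff)

definition lifted_action ::
    "(virasoro_basis \<Rightarrow>\<^sub>0 complex) \<Rightarrow> ('m \<times> (int \<Rightarrow>\<^sub>0 complex) \<Rightarrow>\<^sub>0 complex) \<Rightarrow>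
      ('m \<times> (int \<Rightarrow>\<^sub>0 complex) \<Rightarrow>\<^sub>0 complex)"
  where "lifted_action x f = linear_extension (\<lambda>g. linear_extension (basis_action g) f) x"

abbreviation F where "F \<equiv> carrier (free_space (carrier M \<times> carrier laurent))"
abbreviation N where "N \<equiv> tensor_kernel M laurent"

lemma lifted_action_add_left: "lifted_action (x + y) f = lifted_action x f + lifted_action y f"
  by (simp add: lifted_action_def linear_extension_add)

lemma lifted_action_add_right: "lifted_action x (f + f') = lifted_action x f + lifted_action x f'"
  by (simp add: lifted_action_def linear_extension_add linear_extension_fun_add)

lemma lifted_action_scale_left: "lifted_action (scale a x) f = scale a (lifted_action x f)"
  by (simp add: lifted_action_def linear_extension_scale)

lemma lifted_action_scale_right: "lifted_action x (scale a f) = scale a (lifted_action x f)"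
  by (simp add: lifted_action_def linear_extension_scale linear_extension_fun_scale)

lemmas lifted_action_bilinear = lifted_action_add_left lifted_action_add_right
  lifted_action_scale_left lifted_action_scale_right

lemma lifted_action_zero [simp]: "lifted_action 0 f = 0" "lifted_action x 0 = 0"
  by (simp_all add: lifted_action_def)

lemma lifted_action_diff: "lifted_action x (f - f') = lifted_action x f - lifted_action x f'"
  by (simp add: lifted_action_def linear_extension_diff linear_extension_fun_diff)

lemma lifted_action_generator:
  "lifted_action (vir_d m) (basis_tensor v (t_power n)) = basis_tensor (weight_action m n v) (t_power (n + m))"
  "lifted_action vir_c f = 0"
  by (simp_all add: lifted_action_def vir_d_def vir_c_def basis_action_def t_power_def[of n])

lemma lifted_action_closed:
  assumes "f \<in> F"
  shows "lifted_action x f \<in> F"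
  unfolding lifted_action_def
proof (intro linear_extension_mem free.subspace_carrier)
  fix g p assume "p \<in> Poly_Mapping.keys f"
  then have "fst p \<in> carrier M"
    using assms by auto
  then show "basis_action g p \<in> F"
    by (cases g) (auto simp: basis_action_def finsupp.subspace_0[OF free.subspace_carrier]
        simp del: free_space_carrier laurent_simps
        intro!: linear_extension_mem free.subspace_carrier basis_tensor_carrier, simp)
qed

lemma basis_action_relation:
  assumes "f \<in> tensor_relations M laurent"
  shows "linear_extension (basis_action g) f \<in> N"
proof (cases g)
  case Central
  then show ?thesis
    by (simp add: T.subspace_H finsupp.subspace_0)
next
  case (Gen m)
  let ?b = "\<lambda>v n. basis_tensor (weight_action m n v) (t_power (n + m))"
  have b: "basis_action g (v, w) = linear_extension (?b v) w" for v w
    by (simp add: Gen basis_action_def)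
  consider
      (add_left) u v w where "u \<in> carrier M" "v \<in> carrier M"
        "f = basis_tensor (u \<oplus> v) w - basis_tensor u w - basis_tensor v w"
    | (add_right) v w z where "f = basis_tensor v (w + z) - basis_tensor v w - basis_tensor v z"
    | (smult_left) a v w where "v \<in> carrier M" "f = basis_tensor (a \<odot> v) w - scale a (basis_tensor v w)"
    | (smult_right) a v w where "f = basis_tensor v (scale a w) - scale a (basis_tensor v w)"
    using assms unfolding tensor_relations_def Let_def laurent_simps Un_iff mem_Collect_eq
    by (elim disjE exE conjE) (rule that; assumption)+
  then show ?thesis
  proof cases
    case add_left
    have "linear_extension (basis_action g) f =
        linear_extension (\<lambda>n. ?b (u \<oplus> v) n - ?b u n - ?b v n) w"
      by (simp add: add_left(3) linear_extension_diff b linear_extension_fun_diff)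
    also have "\<dots> \<in> N"
      using add_left(1,2) basis_tensor_add_left
      by (intro linear_extension_mem T.subspace_H) (simp add: weight_action_add)
    finally show ?thesis .
  next
    case add_right
    then show ?thesis
      by (simp add: linear_extension_diff b linear_extension_add T.subspace_H finsupp.subspace_0)
  next
    case smult_left
    have "linear_extension (basis_action g) f =
        linear_extension (\<lambda>n. ?b (a \<odot> v) n - scale a (?b v n)) w"
      by (simp only: smult_left(2) linear_extension_diff linear_extension_scale linear_extension_single b
          linear_extension_fun_diff linear_extension_fun_scale finsupp.scale_one)
    also have "\<dots> \<in> N"
      using smult_left(1) basis_tensor_smult_left
      by (intro linear_extension_mem T.subspace_H) (simp add: weight_action_smult del: Poly_Mapping.map_single)
    finally show ?thesis .
  next
    case smult_right
    then have "linear_extension (basis_action g) f = 0"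
      by (simp only: linear_extension_diff linear_extension_scale linear_extension_single b
          finsupp.scale_one diff_self)
    then show ?thesis
      by (simp add: T.subspace_H finsupp.subspace_0)
  qed
qed

text \<open>This is what makes the action on the tensor product well defined.\<close>

lemma lifted_action_kernel:
  assumes "f \<in> N"
  shows "lifted_action x f \<in> N"
  unfolding lifted_action_def
proof (rule linear_extension_mem[OF T.subspace_H])
  fix g
  interpret L: Vector_Spaces.linear scale scale "linear_extension (basis_action g)"
    by (rule linear_linear_extension)
  have "finsupp.span (tensor_relations M laurent) \<subseteq> {f. linear_extension (basis_action g) f \<in> N}"
    using basis_action_relation by (intro finsupp.span_minimal L.subspace_linear_preimage T.subspace_H) auto
  then show "linear_extension (basis_action g) f \<in> N"
    using assms by (auto simp: tensor_kernel_eq)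
qed

text \<open>The failure of the bracket axiom on representatives; it is trilinear and preserves the kernel.\<close>

definition defect where
  "defect x y f = lifted_action (vir_bracket x y) f -
    (lifted_action x (lifted_action y f) - lifted_action y (lifted_action x f))"

lemma defect_bilinear:
  "defect (x + x') y f = defect x y f + defect x' y f"
  "defect (scale a x) y f = scale a (defect x y f)"
  "defect x (y + y') f = defect x y f + defect x y' f"
  "defect x (scale a y) f = scale a (defect x y f)"
  "defect x y (f + f') = defect x y f + defect x y f'"
  "defect x y (scale a f) = scale a (defect x y f)"
  by (simp_all add: defect_def vir_bracket_bilinear lifted_action_bilinear
      finsupp.scale_right_diff_distrib)

lemma defect_generators:
  assumes v: "v \<in> carrier M"
  shows "defect (Poly_Mapping.single g 1) (Poly_Mapping.single h 1) (basis_tensor v (t_power k)) \<in> N"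
proof (cases "g = Central \<or> h = Central")
  case True
  have "lifted_action (Poly_Mapping.single Central 1) f = 0" for f
    using lifted_action_generator(2) by (simp add: vir_c_def)
  then have "defect (Poly_Mapping.single g 1) (Poly_Mapping.single h 1) (basis_tensor v (t_power k)) = 0"
    using True by (auto simp: defect_def vir_bracket_single)
  then show ?thesis
    by (simp add: T.subspace_H finsupp.subspace_0)
next
  case False
  then obtain m n where gh: "g = Gen m" "h = Gen n"
    by (metis virasoro_basis.exhaust)
  let ?t = "t_power (m + n + k)"
  let ?p = "weight_action (m + n) k v" and ?q = "weight_action n (m + k) (weight_action m k v)"
  \<comment> \<open>The target is written as a combination of two tensor relations; here \<open>b\<close> is the intermediate term \<open>(n - m) p \<otimes> t\<close> with the scalar inside the first factor.\<close>
  have rearrange: "s - (x - q) = - ((x - b - q) + (b - s))" for s x q b :: "'z::ab_group_add"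
    by simp
  have "defect (vir_d m) (vir_d n) (basis_tensor v (t_power k)) =
      scale (of_int (n - m)) (basis_tensor ?p ?t)
        - (basis_tensor (weight_action m (n + k) (weight_action n k v)) ?t - basis_tensor ?q ?t)"
  proof -
    have "vir_bracket (vir_d m) (vir_d n) = basis_bracket (Gen m) (Gen n)"
      by (simp only: vir_d_def vir_bracket_single)
    also have "\<dots> = scale (of_int (n - m)) (vir_d (m + n))
        + scale (if m = - n then (of_int m ^ 3 - of_int m) / 12 else 0) vir_c"
      by (cases "m = - n") (simp_all del: Poly_Mapping.map_single of_int_diff)
    finally have bracket: "vir_bracket (vir_d m) (vir_d n) = \<dots>" .
    have index: "k + n = n + k" "k + m = m + k" "k + (m + n) = m + n + k"
      "n + k + m = m + n + k" "m + k + n = m + n + k"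
      by simp_all
    show ?thesis
      unfolding defect_def bracket lifted_action_bilinear lifted_action_generator index
      by (simp del: Poly_Mapping.map_single of_int_diff)
  qed
  also have "\<dots> = - ((basis_tensor (of_int (n - m) \<odot> ?p \<oplus> ?q) ?t - basis_tensor (of_int (n - m) \<odot> ?p) ?t - basis_tensor ?q ?t)
      + (basis_tensor (of_int (n - m) \<odot> ?p) ?t - scale (of_int (n - m)) (basis_tensor ?p ?t)))"
    unfolding weight_action_commutation[OF v, of m n k] by (rule rearrange)
  also have "\<dots> \<in> N"
    using v by (intro finsupp.subspace_neg finsupp.subspace_add T.subspace_H
        basis_tensor_add_left basis_tensor_smult_left) simp_all
  finally show ?thesis
    by (simp add: gh vir_d_def)
qed

lemma linear_defect:
  "Vector_Spaces.linear scale scale (\<lambda>x. defect x y f)"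
  "Vector_Spaces.linear scale scale (\<lambda>y. defect x y f)"
  "Vector_Spaces.linear scale scale (\<lambda>f. defect x y f)"
  by (unfold_locales; simp add: defect_bilinear)+

lemma defect_kernel:
  assumes "f \<in> N"
  shows "defect x y f \<in> N"
  unfolding defect_def using assms
  by (intro finsupp.subspace_diff T.subspace_H lifted_action_kernel)

text \<open>The generators suffice in all three arguments: in the first two because the defect is linear there,
  in the third because the powers of \<open>t\<close> span modulo the kernel, which the defect
  preserves.\<close>

lemma defect_in_kernel:
  assumes "f \<in> F"
  shows "defect x y f \<in> N"
proof -
  interpret D: Vector_Spaces.linear scale scale "\<lambda>f. defect x y f"
    by (rule linear_defect)
  have "defect x y (basis_tensor v (t_power n)) \<in> N" if "v \<in> carrier M" for v n
    by (rule linear_mem_of_basis[OF linear_defect(1) T.subspace_H],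
        rule linear_mem_of_basis[OF linear_defect(2) T.subspace_H],
        rule defect_generators[OF that])
  then have "finsupp.span (N \<union> {basis_tensor v (t_power n) | v n. v \<in> carrier M}) \<subseteq> {f. defect x y f \<in> N}"
    using defect_kernel by (intro finsupp.span_minimal D.subspace_linear_preimage T.subspace_H) auto
  then show ?thesis
    using free_space_spanned[OF assms] by blast
qed

abbreviation T where "T \<equiv> tensor_space M laurent"

lemma tensor_space_eq: "T = quotient_module (free_space (carrier M \<times> carrier laurent)) N"
  by (simp add: tensor_space_def)

lemma tensor_space_carrier: "carrier T = T.coset ` F"
  unfolding tensor_space_eq by (rule T.quotient_carrier)

text \<open>The choice of a representative is harmless because the lifted action preserves the kernel. Outside
  the carrier the value is \<^const>\<open>undefined\<close>, which is what the extensional function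
  space demands.\<close>

definition action where
  "action = (\<lambda>x. \<lambda>A\<in>carrier T. T.coset (lifted_action x (SOME f. f \<in> A)))"

lemma action_coset:
  assumes "f \<in> F"
  shows "action x (T.coset f) = T.coset (lifted_action x f)"
proof -
  let ?f' = "SOME f'. f' \<in> T.coset f"
  have "f \<in> T.coset f"
    unfolding T.coset_eq by (simp add: T.subspace_H finsupp.subspace_0)
  then have "?f' \<in> T.coset f"
    by (rule someI)
  then have "?f' - f \<in> N"
    unfolding T.coset_eq by simp
  then have "lifted_action x ?f' - lifted_action x f \<in> N"
    unfolding lifted_action_diff[symmetric] by (rule lifted_action_kernel)
  then have "T.coset (lifted_action x ?f') = T.coset (lifted_action x f)"
    by (simp only: T.coset_eq_iff)
  moreover have "T.coset f \<in> carrier T"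
    using assms unfolding tensor_space_carrier by (rule imageI)
  ultimately show ?thesis
    by (simp add: action_def)
qed

lemmas F_closed = finsupp.subspace_add[OF free.subspace_carrier] finsupp.subspace_scale[OF free.subspace_carrier]

lemma action_lie_module: "lie_module complex_field virasoro T action"
proof -
  interpret L: lie_algebra complex_field virasoro
    by (rule lie_algebra_virasoro)
  interpret Q: Module.module complex_field T
    unfolding tensor_space_eq by (rule T.quotient_is_module)
  show ?thesis
  proof (intro lie_module.intro lie_module_axioms.intro L.lie_algebra_axioms Q.module_axioms)
    fix x y A
    assume "A \<in> carrier T"
    then obtain f where f: "f \<in> F" and A: "A = T.coset f"
      unfolding tensor_space_carrier by blast
    show "action x A \<in> carrier T"
      unfolding tensor_space_carrier A action_coset[OF f] by (intro imageI lifted_action_closed f)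
    show "action (x \<oplus>\<^bsub>virasoro\<^esub> y) A = action x A \<oplus>\<^bsub>T\<^esub> action y A"
      unfolding tensor_space_eq virasoro.add_eq A action_coset[OF f] T.quotient_add lifted_action_add_left ..
    show "action (a \<odot>\<^bsub>virasoro\<^esub> x) A = a \<odot>\<^bsub>T\<^esub> action x A" for a
      unfolding tensor_space_eq virasoro.smult_eq A action_coset[OF f] T.quotient_smult lifted_action_scale_left ..
    show "action x (a \<odot>\<^bsub>T\<^esub> A) = a \<odot>\<^bsub>T\<^esub> action x A" for a
      unfolding tensor_space_eq A T.quotient_smult action_coset[OF f] action_coset[OF F_closed(2)[OF f]]
        lifted_action_scale_right ..
    show "action x (A \<oplus>\<^bsub>T\<^esub> B) = action x A \<oplus>\<^bsub>T\<^esub> action x B" if B: "B \<in> carrier T" for B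
    proof -
      obtain f' where f': "f' \<in> F" and B: "B = T.coset f'"
        using B unfolding tensor_space_carrier by blast
      show ?thesis
        unfolding tensor_space_eq A B T.quotient_add action_coset[OF f] action_coset[OF f']
          action_coset[OF F_closed(1)[OF f f']] lifted_action_add_right ..
    qed
    show "action (x \<otimes>\<^bsub>virasoro\<^esub> y) A = action x (action y A) \<ominus>\<^bsub>T\<^esub> action y (action x A)"
      unfolding tensor_space_eq virasoro_simps A action_coset[OF f] action_coset[OF lifted_action_closed[OF f]]
        T.quotient_minus[OF lifted_action_closed[OF lifted_action_closed[OF f]] lifted_action_closed[OF lifted_action_closed[OF f]]]
        T.coset_eq_iff
      using defect_in_kernel[OF f, of x y] by (simp only: defect_def)
  qed
qed

lemma action_generators:
  assumes "v \<in> carrier M"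
  shows "action (vir_d m) (pure_tensor M laurent v (t_power n)) =
      pure_tensor M laurent (weight_action m n v) (t_power (n + m))"
    and "action vir_c (pure_tensor M laurent v (t_power n)) = \<zero>\<^bsub>T\<^esub>"
proof -
  have f: "basis_tensor v (t_power n) \<in> F"
    using assms by simp
  show "action (vir_d m) (pure_tensor M laurent v (t_power n)) =
      pure_tensor M laurent (weight_action m n v) (t_power (n + m))"
    unfolding pure_tensor_eq action_coset[OF f] lifted_action_generator ..
  show "action vir_c (pure_tensor M laurent v (t_power n)) = \<zero>\<^bsub>T\<^esub>"
    unfolding pure_tensor_eq action_coset[OF f] lifted_action_generator tensor_space_eq T.quotient_zero ..
qed

lemma action_extensional: "action \<in> carrier virasoro \<rightarrow>\<^sub>E carrier T \<rightarrow>\<^sub>E carrier T"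
proof -
  interpret A: lie_module complex_field virasoro T action
    by (rule action_lie_module)
  show ?thesis
    using A.act_closed by (intro PiE_I) (auto simp: action_def)
qed

text \<open>The vectors on which both actions agree form a subspace; on the level of representatives it contains
  the kernel and the \<open>(v, t\<^sup>n)\<close>, hence everything.\<close>

lemma lie_module_determined:
  assumes "lie_module complex_field virasoro T act" "lie_module complex_field virasoro T act'"
    and agree: "\<And>g v n. v \<in> carrier M \<Longrightarrow>
      act (Poly_Mapping.single g 1) (pure_tensor M laurent v (t_power n)) =
      act' (Poly_Mapping.single g 1) (pure_tensor M laurent v (t_power n))"
    and "A \<in> carrier T"
  shows "act x A = act' x A"
proof -
  interpret A: lie_module complex_field virasoro T act by fact
  interpret B: lie_module complex_field virasoro T act' by fact
  have zero_left: "act 0 A = \<zero>\<^bsub>T\<^esub>" "act' 0 A = \<zero>\<^bsub>T\<^esub>" if "A \<in> carrier T" for A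
    using A.act_smult_left[of 0 0 A] B.act_smult_left[of 0 0 A] that
      A.act_closed[of 0 A] B.act_closed[of 0 A] A.M.smult_l_null by simp_all
  have zero_right: "act x \<zero>\<^bsub>T\<^esub> = \<zero>\<^bsub>T\<^esub>" "act' x \<zero>\<^bsub>T\<^esub> = \<zero>\<^bsub>T\<^esub>" for x
    using A.act_smult_right[of 0 x "\<zero>\<^bsub>T\<^esub>"] B.act_smult_right[of 0 x "\<zero>\<^bsub>T\<^esub>"]
      A.act_closed[of x "\<zero>\<^bsub>T\<^esub>"] B.act_closed[of x "\<zero>\<^bsub>T\<^esub>"] A.M.smult_l_null by simp_all
  have pure_carrier: "pure_tensor M laurent v w \<in> carrier T" if "v \<in> carrier M" for v w
    unfolding tensor_space_carrier pure_tensor_eq using that by (intro imageI) simp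
  have pure: "act x (pure_tensor M laurent v (t_power n)) = act' x (pure_tensor M laurent v (t_power n))"
    if v: "v \<in> carrier M" for x v n
  proof -
    let ?p = "pure_tensor M laurent v (t_power n)"
    have "x \<in> {x. act x ?p = act' x ?p}"
    proof (rule subspace_mem_of_basis[OF finsupp.subspaceI])
      show "0 \<in> {x. act x ?p = act' x ?p}"
        using zero_left[OF pure_carrier[OF v]] by simp
      show "x + y \<in> {x. act x ?p = act' x ?p}"
        if "x \<in> {x. act x ?p = act' x ?p}" "y \<in> {x. act x ?p = act' x ?p}" for x y
        using that A.act_add_left[of x y ?p] B.act_add_left[of x y ?p] pure_carrier[OF v] by simp
      show "scale a x \<in> {x. act x ?p = act' x ?p}" if "x \<in> {x. act x ?p = act' x ?p}" for a x
        using that A.act_smult_left[of a x ?p] B.act_smult_left[of a x ?p] pure_carrier[OF v] by simp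
    qed (simp add: agree[OF v])
    then show ?thesis by simp
  qed
  have x: "x \<in> carrier virasoro" and a: "a \<in> carrier complex_field" for a
    by simp_all
  let ?H = "{f \<in> F. act x (T.coset f) = act' x (T.coset f)}"
  have coset_carrier: "T.coset f \<in> carrier T" if "f \<in> F" for f
    unfolding tensor_space_carrier using that by (rule imageI)
  have zero_coset: "T.coset f = \<zero>\<^bsub>T\<^esub>" if "f \<in> N" for f
    unfolding tensor_space_eq T.quotient_zero T.coset_eq_iff using that by simp
  have "finsupp.subspace ?H"
  proof (rule finsupp.subspaceI)
    show "0 \<in> ?H"
      using zero_right[of x] zero_coset[of 0] by (simp add: finsupp.subspace_0 T.subspace_H)
    show "f + f' \<in> ?H" if "f \<in> ?H" "f' \<in> ?H" for f f'
    proof -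
      have f: "f \<in> F" "f' \<in> F" and eq: "act x (T.coset f) = act' x (T.coset f)" "act x (T.coset f') = act' x (T.coset f')"
        using that by simp_all
      have "T.coset (f + f') = T.coset f \<oplus>\<^bsub>T\<^esub> T.coset f'"
        unfolding tensor_space_eq T.quotient_add ..
      then have "act x (T.coset (f + f')) = act' x (T.coset (f + f'))"
        using A.act_add_right[OF x f[THEN coset_carrier]] B.act_add_right[OF x f[THEN coset_carrier]]
        by (simp only: eq)
      then show ?thesis
        using F_closed(1)[OF f] by blast
    qed
    show "scale a f \<in> ?H" if "f \<in> ?H" for a f
    proof -
      have f: "f \<in> F" and eq: "act x (T.coset f) = act' x (T.coset f)"
        using that by simp_all
      have "T.coset (scale a f) = a \<odot>\<^bsub>T\<^esub> T.coset f"
        unfolding tensor_space_eq T.quotient_smult ..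
      then have "act x (T.coset (scale a f)) = act' x (T.coset (scale a f))"
        using A.act_smult_right[OF a x coset_carrier[OF f]] B.act_smult_right[OF a x coset_carrier[OF f]]
        by (simp only: eq)
      then show ?thesis
        using F_closed(2)[OF f] by blast
    qed
  qed
  moreover have "N \<subseteq> ?H"
  proof
    fix f assume f: "f \<in> N"
    have "act x (T.coset f) = act' x (T.coset f)"
      unfolding zero_coset[OF f] zero_right ..
    then show "f \<in> ?H"
      using f T.H_carrier by blast
  qed
  moreover have "{basis_tensor v (t_power n) | v n. v \<in> carrier M} \<subseteq> ?H"
    using pure by (auto simp: pure_tensor_eq)
  ultimately have "finsupp.span (N \<union> {basis_tensor v (t_power n) | v n. v \<in> carrier M}) \<subseteq> ?H"
    by (intro finsupp.span_minimal) auto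
  moreover obtain f where "f \<in> F" "A = T.coset f"
    using \<open>A \<in> carrier T\<close> unfolding tensor_space_carrier by blast
  ultimately show ?thesis
    using free_space_spanned[of f] by blast
qed

end

theorem proposition1:
  fixes r :: nat
    and M :: "(complex, 'm, 'x) module_scheme"
    and \<rho> :: "(virasoro_basis \<Rightarrow>\<^sub>0 complex) set \<Rightarrow> 'm \<Rightarrow> 'm"
    and \<alpha> :: complex
  assumes "lie_module complex_field (a_algebra r) M \<rho>"
  shows "\<exists>!act.
    act \<in> carrier virasoro \<rightarrow>\<^sub>E carrier (tensor_space M laurent) \<rightarrow>\<^sub>E carrier (tensor_space M laurent) \<and>
    lie_module complex_field virasoro (tensor_space M laurent) act \<and>
    (\<forall>m n. \<forall>v\<in>carrier M.
      act (vir_d m) (pure_tensor M laurent v (t_power n)) =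
        pure_tensor M laurent
          ((\<alpha> + of_int n) \<odot>\<^bsub>M\<^esub> v \<oplus>\<^bsub>M\<^esub>
            (\<Oplus>\<^bsub>M\<^esub>i\<in>{0..r}. (of_int m ^ (i + 1) / fact (i + 1)) \<odot>\<^bsub>M\<^esub> \<rho> (d_bar r (int i)) v))
          (t_power (n + m)) \<and>
      act vir_c (pure_tensor M laurent v (t_power n)) = \<zero>\<^bsub>tensor_space M laurent\<^esub>)"
    (is "\<exists>!act. ?ext act \<and> ?lie act \<and> ?gen act")
proof -
  interpret virasoro_action r M \<rho> \<alpha>
    by (rule virasoro_action.intro[OF assms])
  show ?thesis
  proof (rule ex1I[of _ action])
    show "?ext action \<and> ?lie action \<and> ?gen action"
      using action_extensional action_lie_module action_generators
      by (simp add: weight_action_def exp_action_eq)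
  next
    fix act assume act: "?ext act \<and> ?lie act \<and> ?gen act"
    show "act = action"
    proof (rule PiE_ext)
      show "act \<in> carrier virasoro \<rightarrow>\<^sub>E carrier T \<rightarrow>\<^sub>E carrier T"
        using act by blast
      show "action \<in> carrier virasoro \<rightarrow>\<^sub>E carrier T \<rightarrow>\<^sub>E carrier T"
        by (rule action_extensional)
      fix x assume x: "x \<in> carrier virasoro"
      show "act x = action x"
      proof (rule PiE_ext)
        show "act x \<in> carrier T \<rightarrow>\<^sub>E carrier T" "action x \<in> carrier T \<rightarrow>\<^sub>E carrier T"
          using act action_extensional x by (blast dest: PiE_mem)+
        fix A assume "A \<in> carrier T"
        then show "act x A = action x A"
        proof (rule lie_module_determined[rotated 3])
          fix g v n assume v: "v \<in> carrier M"
          show "act (Poly_Mapping.single g 1) (pure_tensor M laurent v (t_power n)) =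
              action (Poly_Mapping.single g 1) (pure_tensor M laurent v (t_power n))"
            using act action_generators[OF v] v
            by (cases g) (simp_all add: vir_d_def vir_c_def weight_action_def exp_action_eq)
        qed (use act action_lie_module in blast)+
      qed
    qed
  qed
qed

end
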